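(* Let $\Gamma=\langle x,y\mid x^2=y^3\rangle$ be the group of the trefoil knot. Let $R^{irr}\subset R(\Gamma,\mathrm{SL}_3(\mathbf C))$ be the subset of irreducible representations and let $\overline{R^{irr}}$ be its Zariski closure in $R(\Gamma,\mathrm{SL}_3(\mathbf C))$. Then the GIT quotient $\overline{R^{irr}}/\!/\mathrm{SL}_3(\mathbf C)$ is isomorphic to $\mathbf C^2$. Moreover, the Zariski open subset $R^{irr}$ is $\mathrm{SL}_3(\mathbf C)$-invariant and its GIT quotient is isomorphic to the complement of three affine lines in general position in $\mathbf C^2$.
   Context: $R(\Gamma,\mathrm{SL}_3(\mathbf C))=\mathrm{Hom}(\Gamma,\mathrm{SL}_3(\mathbf C))$ is the affine algebraic set of representations, on which $\mathrm{SL}_3(\mathbf C)$ acts by conjugation; GIT quotients are taken with respect to this action. Three affine lines in $\mathbf C^2$ are in general position if they intersect pairwise in single points and are not concurrent. *)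

theory Defs
  imports "HOL-Analysis.Analysis" "HOL-Algebra.Group"
begin

section \<open>Finitely presented groups\<close>

text \<open>A letter \<open>(g, True)\<close> stands for the generator \<open>g\<close>, and \<open>(g, False)\<close> for its
  formal inverse. A relation \<open>l = r\<close> is the pair \<open>(l, r)\<close> of words.\<close>

type_synonym 'g word = "('g \<times> bool) list"

inductive word_equiv :: "('g word \<times> 'g word) set \<Rightarrow> 'g word \<Rightarrow> 'g word \<Rightarrow> bool"
  for Rel where
  refl: "word_equiv Rel u u"
| sym: "word_equiv Rel u v \<Longrightarrow> word_equiv Rel v u"
| trans: "word_equiv Rel u v \<Longrightarrow> word_equiv Rel v w \<Longrightarrow> word_equiv Rel u w"
| cancel: "word_equiv Rel (u @ [(g, b), (g, \<not> b)] @ v) (u @ v)"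
| relation: "(l, r) \<in> Rel \<Longrightarrow> word_equiv Rel (u @ l @ v) (u @ r @ v)"

definition word_class :: "('g word \<times> 'g word) set \<Rightarrow> 'g word \<Rightarrow> 'g word set" where
  "word_class Rel u = {v. word_equiv Rel u v}"

definition presented_group :: "('g word \<times> 'g word) set \<Rightarrow> 'g word set monoid" where
  "presented_group Rel =
     \<lparr>carrier = range (word_class Rel),
      monoid.mult = (\<lambda>U V. \<Union>u\<in>U. \<Union>v\<in>V. word_class Rel (u @ v)),
      one = word_class Rel []\<rparr>"

lemma word_class_eq_iff: "word_class Rel u = word_class Rel v \<longleftrightarrow> word_equiv Rel u v"
  unfolding word_class_def
  by (auto intro: word_equiv.refl word_equiv.sym word_equiv.trans)

lemma word_equiv_append_left: "word_equiv Rel u v \<Longrightarrow> word_equiv Rel (w @ u) (w @ v)"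
proof (induction rule: word_equiv.induct)
  case (cancel u g b v)
  show ?case using word_equiv.cancel[of Rel "w @ u" g b v] by simp
next
  case (relation l r u v)
  then show ?case using word_equiv.relation[of l r Rel "w @ u" v] by simp
qed (auto intro: word_equiv.intros)

lemma word_equiv_append_right: "word_equiv Rel u v \<Longrightarrow> word_equiv Rel (u @ w) (v @ w)"
proof (induction rule: word_equiv.induct)
  case (cancel u g b v)
  show ?case using word_equiv.cancel[of Rel u g b "v @ w"] by simp
next
  case (relation l r u v)
  then show ?case using word_equiv.relation[of l r Rel u "v @ w"] by simp
qed (auto intro: word_equiv.intros)

lemma word_class_mult:
  "word_class Rel u \<otimes>\<^bsub>presented_group Rel\<^esub> word_class Rel v = word_class Rel (u @ v)"
proof -
  have "word_class Rel (u' @ v') = word_class Rel (u @ v)"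
    if "word_equiv Rel u u'" "word_equiv Rel v v'" for u' v'
    using that by (metis word_class_eq_iff word_equiv_append_left word_equiv_append_right)
  then show ?thesis
    unfolding presented_group_def by (auto simp: word_class_def intro: word_equiv.refl)
qed

lemma word_equiv_inverse:
  "word_equiv Rel (map (\<lambda>(g, b). (g, \<not> b)) (rev u) @ u) []"
proof (induction u)
  case Nil
  show ?case by (simp add: word_equiv.refl)
next
  case (Cons a u)
  obtain g b where a: "a = (g, b)" by (cases a)
  have "word_equiv Rel (map (\<lambda>(g, b). (g, \<not> b)) (rev u) @ [(g, \<not> b), (g, \<not> \<not> b)] @ u)
      (map (\<lambda>(g, b). (g, \<not> b)) (rev u) @ u)"
    by (rule word_equiv.cancel)
  then show ?case using Cons a by (auto intro: word_equiv.trans)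
qed

lemma group_presented_group: "group (presented_group Rel)"
proof (rule groupI)
  let ?G = "presented_group Rel"
  have carr: "carrier ?G = range (word_class Rel)" and one: "\<one>\<^bsub>?G\<^esub> = word_class Rel []"
    by (simp_all add: presented_group_def)
  show "\<And>x y. x \<in> carrier ?G \<Longrightarrow> y \<in> carrier ?G \<Longrightarrow> x \<otimes>\<^bsub>?G\<^esub> y \<in> carrier ?G"
    by (auto simp: carr word_class_mult)
  show "\<one>\<^bsub>?G\<^esub> \<in> carrier ?G" by (simp add: carr one)
  show "\<And>x y z. x \<in> carrier ?G \<Longrightarrow> y \<in> carrier ?G \<Longrightarrow> z \<in> carrier ?G \<Longrightarrow>
      x \<otimes>\<^bsub>?G\<^esub> y \<otimes>\<^bsub>?G\<^esub> z = x \<otimes>\<^bsub>?G\<^esub> (y \<otimes>\<^bsub>?G\<^esub> z)"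
    by (auto simp: carr word_class_mult)
  show "\<And>x. x \<in> carrier ?G \<Longrightarrow> \<one>\<^bsub>?G\<^esub> \<otimes>\<^bsub>?G\<^esub> x = x"
    by (auto simp: carr one word_class_mult)
  fix x assume "x \<in> carrier ?G"
  then obtain u where u: "x = word_class Rel u" by (auto simp: carr)
  let ?v = "map (\<lambda>(g, b). (g, \<not> b)) (rev u)"
  have "word_class Rel ?v \<otimes>\<^bsub>?G\<^esub> x = \<one>\<^bsub>?G\<^esub>"
    unfolding u one word_class_mult word_class_eq_iff by (rule word_equiv_inverse)
  moreover have "word_class Rel ?v \<in> carrier ?G" by (simp add: carr)
  ultimately show "\<exists>y\<in>carrier ?G. y \<otimes>\<^bsub>?G\<^esub> x = \<one>\<^bsub>?G\<^esub>" by blast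
qed

datatype trefoil_gen = Gen_x | Gen_y

definition trefoil_relations :: "(trefoil_gen word \<times> trefoil_gen word) set" where
  "trefoil_relations =
     {([(Gen_x, True), (Gen_x, True)], [(Gen_y, True), (Gen_y, True), (Gen_y, True)])}"

definition trefoil_group :: "trefoil_gen word set monoid" where
  "trefoil_group = presented_group trefoil_relations"

definition trefoil_x :: "trefoil_gen word set" where
  "trefoil_x = word_class trefoil_relations [(Gen_x, True)]"

definition trefoil_y :: "trefoil_gen word set" where
  "trefoil_y = word_class trefoil_relations [(Gen_y, True)]"


section \<open>Varieties as sets with a ring of functions\<close>

text \<open>The ambient affine space is given by a set \<open>C\<close> of coordinate functions on a type of
  points. All functions on a set \<open>X\<close> of points are taken to be extensional, that is,
  \<open>undefined\<close> outside \<open>X\<close>.\<close>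

inductive_set poly_functions :: "('p \<Rightarrow> complex) set \<Rightarrow> ('p \<Rightarrow> complex) set"
  for C :: "('p \<Rightarrow> complex) set" where
  const: "(\<lambda>_. c) \<in> poly_functions C"
| coord: "f \<in> C \<Longrightarrow> f \<in> poly_functions C"
| add: "f \<in> poly_functions C \<Longrightarrow> g \<in> poly_functions C \<Longrightarrow> (\<lambda>p. f p + g p) \<in> poly_functions C"
| mult: "f \<in> poly_functions C \<Longrightarrow> g \<in> poly_functions C \<Longrightarrow> (\<lambda>p. f p * g p) \<in> poly_functions C"

definition zariski :: "('p \<Rightarrow> complex) set \<Rightarrow> 'p set \<Rightarrow> 'p topology" where
  "zariski C X =
     topology (\<lambda>U. \<exists>S \<subseteq> poly_functions C. U = X - {p \<in> X. \<forall>f\<in>S. f p = 0})"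

lemma istopology_zariski:
  "istopology (\<lambda>U. \<exists>S \<subseteq> poly_functions C. U = X - {p \<in> X. \<forall>f\<in>S. f p = 0})"
  (is "istopology ?op")
proof -
  have op: "?op U \<longleftrightarrow> (\<exists>S \<subseteq> poly_functions C. \<forall>x. x \<in> U \<longleftrightarrow> x \<in> X \<and> (\<exists>f\<in>S. f x \<noteq> 0))"
    for U
    by (intro ex_cong1 conj_cong refl) (auto simp: set_eq_iff)
  have "?op (U \<inter> V)" if U: "?op U" and V: "?op V" for U V
  proof -
    obtain S where S: "S \<subseteq> poly_functions C" "\<And>x. x \<in> U \<longleftrightarrow> x \<in> X \<and> (\<exists>f\<in>S. f x \<noteq> 0)"
      using U unfolding op by (elim exE conjE) simp
    obtain T where T: "T \<subseteq> poly_functions C" "\<And>x. x \<in> V \<longleftrightarrow> x \<in> X \<and> (\<exists>f\<in>T. f x \<noteq> 0)"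
      using V unfolding op by (elim exE conjE) simp
    define P where "P = (\<lambda>(f, g) p. f p * g p) ` (S \<times> T)"
    have "P \<subseteq> poly_functions C"
      using S(1) T(1) unfolding P_def by (auto intro!: poly_functions.mult)
    moreover have "x \<in> U \<inter> V \<longleftrightarrow> x \<in> X \<and> (\<exists>f\<in>P. f x \<noteq> 0)" for x
      by (auto simp: S(2) T(2) P_def)
    ultimately show ?thesis unfolding op by (intro exI[of _ P]) simp
  qed
  moreover have "?op (\<Union>\<U>)" if \<U>: "\<forall>U\<in>\<U>. ?op U" for \<U>
  proof -
    define S where "S = {f \<in> poly_functions C. \<forall>x\<in>X. f x \<noteq> 0 \<longrightarrow> x \<in> \<Union>\<U>}"
    have "x \<in> \<Union>\<U> \<longleftrightarrow> x \<in> X \<and> (\<exists>f\<in>S. f x \<noteq> 0)" for x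
    proof
      assume "x \<in> \<Union>\<U>"
      then obtain U where U: "U \<in> \<U>" "x \<in> U" by blast
      then obtain T where T: "T \<subseteq> poly_functions C"
          "\<And>x. x \<in> U \<longleftrightarrow> x \<in> X \<and> (\<exists>f\<in>T. f x \<noteq> 0)"
        using bspec[OF \<U> U(1)] unfolding op by (elim exE conjE) simp
      with U obtain f where f: "f \<in> T" "f x \<noteq> 0" "x \<in> X" by blast
      then have "f \<in> S" using T U(1) unfolding S_def by blast
      with f show "x \<in> X \<and> (\<exists>f\<in>S. f x \<noteq> 0)" by blast
    qed (auto simp: S_def)
    moreover have "S \<subseteq> poly_functions C" by (auto simp: S_def)
    ultimately show ?thesis unfolding op by (intro exI[of _ S]) simp
  qed
  ultimately show ?thesis unfolding istopology_def by simp
qed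

lemma openin_zariski:
  "openin (zariski C X) U \<longleftrightarrow>
     (\<exists>S \<subseteq> poly_functions C. U = X - {p \<in> X. \<forall>f\<in>S. f p = 0})"
  unfolding zariski_def topology_inverse'[OF istopology_zariski] ..

lemma topspace_zariski: "topspace (zariski C X) = X"
proof -
  have "X = X - {p \<in> X. \<forall>f\<in>{\<lambda>_. 1 :: complex}. f p = 0}" by auto
  then have "openin (zariski C X) X"
    unfolding openin_zariski using poly_functions.const by blast
  then have "X \<subseteq> topspace (zariski C X)" by (rule openin_subset)
  moreover have "topspace (zariski C X) \<subseteq> X"
    using openin_topspace[of "zariski C X"] unfolding openin_zariski by blast
  ultimately show ?thesis by blast
qed

text \<open>Regular functions are those that are locally quotients of polynomials. This applies
  uniformly to closed sets, where it gives exactly the restrictions of polynomials, and to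
  locally closed ones.\<close>

definition regular_functions :: "('p \<Rightarrow> complex) set \<Rightarrow> 'p set \<Rightarrow> ('p \<Rightarrow> complex) set" where
  "regular_functions C X = {f \<in> extensional X. \<forall>x\<in>X.
     \<exists>V a b. openin (zariski C X) V \<and> x \<in> V \<and> a \<in> poly_functions C \<and> b \<in> poly_functions C \<and>
       (\<forall>y\<in>V. b y \<noteq> 0 \<and> f y = a y / b y)}"

text \<open>An affine variety is determined up to isomorphism by its points and its global regular
  functions, and isomorphisms are the bijections that identify these functions. The notions
  below are meant for affine varieties only. The locally closed sets they are applied to, the
  irreducible representations of the trefoil group and the complement of three lines in the
  plane, are principal open subsets of closed sets, hence affine.\<close>

record 'p variety =
  points :: "'p set"
  regular :: "('p \<Rightarrow> complex) set"

definition subvariety :: "('p \<Rightarrow> complex) set \<Rightarrow> 'p set \<Rightarrow> 'p variety" where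
  "subvariety C X = \<lparr>points = X, regular = regular_functions C X\<rparr>"

definition variety_isomorphic :: "'p variety \<Rightarrow> 'q variety \<Rightarrow> bool" where
  "variety_isomorphic V W \<longleftrightarrow>
     (\<exists>h. bij_betw h (points V) (points W) \<and>
          regular V = (\<lambda>f. restrict (f \<circ> h) (points V)) ` regular W)"


section \<open>GIT quotients\<close>

definition invariant_functions ::
    "('g, 'm) monoid_scheme \<Rightarrow> ('g \<Rightarrow> 'p \<Rightarrow> 'p) \<Rightarrow> 'p variety \<Rightarrow> ('p \<Rightarrow> complex) set" where
  "invariant_functions G act V =
     {f \<in> regular V. \<forall>g\<in>carrier G. \<forall>p\<in>points V. f (act g p) = f p}"

text \<open>The complex algebra homomorphisms from an algebra \<open>A\<close> of functions on \<open>X\<close> to the complex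
  numbers; for finitely generated \<open>A\<close> these are the points of its maximal spectrum.
  Preservation of constants covers both the unit and scalar multiplication.\<close>

definition algebra_characters ::
    "'p set \<Rightarrow> ('p \<Rightarrow> complex) set \<Rightarrow> (('p \<Rightarrow> complex) \<Rightarrow> complex) set" where
  "algebra_characters X A = {\<xi> \<in> extensional A.
     (\<forall>c. \<xi> (\<lambda>p\<in>X. c) = c) \<and>
     (\<forall>f\<in>A. \<forall>g\<in>A. \<xi> (\<lambda>p\<in>X. f p + g p) = \<xi> f + \<xi> g) \<and>
     (\<forall>f\<in>A. \<forall>g\<in>A. \<xi> (\<lambda>p\<in>X. f p * g p) = \<xi> f * \<xi> g)}"

text \<open>The maximal spectrum of the algebra \<open>A\<close> of invariants, each \<open>f \<in> A\<close> being regarded as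
  the function that evaluates characters at \<open>f\<close>.\<close>

definition GIT_quotient ::
    "('g, 'm) monoid_scheme \<Rightarrow> ('g \<Rightarrow> 'p \<Rightarrow> 'p) \<Rightarrow> 'p variety \<Rightarrow> (('p \<Rightarrow> complex) \<Rightarrow> complex) variety"
  where
  "GIT_quotient G act V =
     (let A = invariant_functions G act V; P = algebra_characters (points V) A
      in \<lparr>points = P, regular = (\<lambda>f. \<lambda>\<xi>\<in>P. \<xi> f) ` A\<rparr>)"


section \<open>Representations in the special linear group\<close>

definition SL :: "(complex ^ 'n ^ 'n) monoid" where
  "SL = \<lparr>carrier = {A. det A = 1}, monoid.mult = (**), one = mat 1\<rparr>"

lemma group_SL: "group (SL :: (complex ^ 'n ^ 'n) monoid)"
proof (rule groupI)
  fix A :: "complex ^ 'n ^ 'n"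
  assume "A \<in> carrier SL"
  then have A: "det A = 1" by (simp add: SL_def)
  then obtain B where B: "B ** A = mat 1"
    by (metis invertible_det_nz invertible_left_inverse zero_neq_one)
  then have "det B = 1" using A det_mul[of B A] by simp
  then show "\<exists>B\<in>carrier SL. B \<otimes>\<^bsub>SL\<^esub> A = \<one>\<^bsub>SL\<^esub>"
    using B by (auto simp: SL_def)
qed (auto simp: SL_def det_mul matrix_mul_assoc)

definition representations :: "('a, 'm) monoid_scheme \<Rightarrow> ('a \<Rightarrow> complex ^ 'n ^ 'n) set" where
  "representations G = hom G SL \<inter> extensional (carrier G)"

definition conjugate ::
    "('a, 'm) monoid_scheme \<Rightarrow> complex ^ 'n ^ 'n \<Rightarrow> ('a \<Rightarrow> complex ^ 'n ^ 'n) \<Rightarrow>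
       ('a \<Rightarrow> complex ^ 'n ^ 'n)" where
  "conjugate G g \<rho> = (\<lambda>\<gamma>\<in>carrier G. g \<otimes>\<^bsub>SL\<^esub> \<rho> \<gamma> \<otimes>\<^bsub>SL\<^esub> inv\<^bsub>SL\<^esub> g)"

definition irreducible_rep ::
    "('a, 'm) monoid_scheme \<Rightarrow> ('a \<Rightarrow> complex ^ 'n ^ 'n) \<Rightarrow> bool" where
  "irreducible_rep G \<rho> \<longleftrightarrow>
     (\<forall>W. vec.subspace W \<and> (\<forall>\<gamma>\<in>carrier G. \<forall>w\<in>W. \<rho> \<gamma> *v w \<in> W) \<longrightarrow> W = {0} \<or> W = UNIV)"

text \<open>For a finite generating set \<open>S\<close> of the group, these coordinates embed the set of
  representations as a Zariski closed subset of a product of matrix spaces.\<close>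

definition rep_coords :: "'a set \<Rightarrow> (('a \<Rightarrow> complex ^ 'n ^ 'n) \<Rightarrow> complex) set" where
  "rep_coords S = {(\<lambda>\<rho>. \<rho> \<gamma> $ i $ j) |\<gamma> i j. \<gamma> \<in> S}"

abbreviation trefoil_coords ::
    "((trefoil_gen word set \<Rightarrow> complex ^ 3 ^ 3) \<Rightarrow> complex) set" where
  "trefoil_coords \<equiv> rep_coords {trefoil_x, trefoil_y}"

definition R_trefoil :: "(trefoil_gen word set \<Rightarrow> complex ^ 3 ^ 3) set" where
  "R_trefoil = representations trefoil_group"

definition R_irr_trefoil :: "(trefoil_gen word set \<Rightarrow> complex ^ 3 ^ 3) set" where
  "R_irr_trefoil = {\<rho> \<in> R_trefoil. irreducible_rep trefoil_group \<rho>}"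

definition R_irr_closure_trefoil :: "(trefoil_gen word set \<Rightarrow> complex ^ 3 ^ 3) set" where
  "R_irr_closure_trefoil = zariski trefoil_coords R_trefoil closure_of R_irr_trefoil"


section \<open>The affine plane and its lines\<close>

definition affine_coords :: "(complex ^ 'n \<Rightarrow> complex) set" where
  "affine_coords = {(\<lambda>v. v $ i) |i. True}"

definition complex_affine_line :: "(complex ^ 'n) set \<Rightarrow> bool" where
  "complex_affine_line L \<longleftrightarrow> (\<exists>p d. d \<noteq> 0 \<and> L = {p + c *s d |c. True})"

definition lines_general_position ::
    "(complex ^ 2) set \<Rightarrow> (complex ^ 2) set \<Rightarrow> (complex ^ 2) set \<Rightarrow> bool" where
  "lines_general_position L1 L2 L3 \<longleftrightarrow>
     (\<exists>p. L1 \<inter> L2 = {p}) \<and> (\<exists>p. L1 \<inter> L3 = {p}) \<and> (\<exists>p. L2 \<inter> L3 = {p}) \<and>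
     L1 \<inter> L2 \<inter> L3 = {}"

end

theory Submission
  imports Defs "HOL-Computational_Algebra.Fundamental_Theorem_Algebra"
begin

text \<open>
  Let \<open>\<rho>\<close> be irreducible, with \<open>A\<close> and \<open>B\<close> the images of \<open>x\<close> and \<open>y\<close>. By Schur's lemma
  \<open>A\<^sup>2 = B\<^sup>3\<close> is a scalar. If \<open>B\<close> had fewer than three eigenvalues, then \<open>A\<close> and \<open>B\<close>
  would both be quadratic, and an eigenvector \<open>w\<close> of \<open>A B\<close> would span with \<open>A w\<close> an
  invariant subspace. So \<open>B\<close> has the three cube roots of the scalar as eigenvalues, their
  product \<open>1\<close> is that scalar, and \<open>B\<close> is conjugate to \<open>diag (1, \<omega>, \<omega>\<^sup>2)\<close>. In the eigenbasis
  of \<open>B\<close> the matrix \<open>A + 1\<close> has rank one; scaling the basis makes its rows constant, equal to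
  \<open>2 s\<^sub>i\<close> with \<open>s\<^sub>1 + s\<^sub>2 + s\<^sub>3 = 1\<close>, and irreducibility means that no \<open>s\<^sub>i\<close> vanishes.

  The \<open>s\<^sub>i\<close> are traces of polynomials in \<open>A\<close> and \<open>B\<close>, so they give an invariant polynomial
  map to the plane, for which the normal form is a polynomial section. By density every invariant
  function on the closure factors through it, and the complement of the three lines \<open>s\<^sub>i = 0\<close>
  corresponds to the irreducible representations. These form a principal open subset since
  \<open>det [B, A B A - A B]\<close> vanishes on reducible pairs and equals \<open>432 s\<^sub>1 s\<^sub>2 s\<^sub>3\<close> on the
  normal forms.
\<close>

section \<open>Polynomial maps and regular functions\<close>

lemma poly_functions_diff:
  assumes "f \<in> poly_functions C" "g \<in> poly_functions C"
  shows "(\<lambda>p. f p - g p) \<in> poly_functions C"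
proof -
  have "(\<lambda>p. f p + (\<lambda>_. -1) p * g p) \<in> poly_functions C"
    by (intro poly_functions.add poly_functions.mult poly_functions.const assms)
  then show ?thesis by simp
qed

lemma poly_functions_sum:
  assumes "\<And>i. i \<in> I \<Longrightarrow> f i \<in> poly_functions C"
  shows "(\<lambda>p. \<Sum>i\<in>I. f i p) \<in> poly_functions C"
  using assms
proof (induction I rule: infinite_finite_induct)
  case (insert i I)
  then show ?case by (auto intro!: poly_functions.add)
qed (auto intro: poly_functions.const)

lemma poly_functions_prod:
  assumes "\<And>i. i \<in> I \<Longrightarrow> f i \<in> poly_functions C"
  shows "(\<lambda>p. \<Prod>i\<in>I. f i p) \<in> poly_functions C"
  using assms
proof (induction I rule: infinite_finite_induct)
  case (insert i I)
  then show ?case by (auto intro!: poly_functions.mult)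
qed (auto intro: poly_functions.const)

text \<open>Only coordinates are tested, so that polynomiality can be checked entry by entry;
  \<open>poly_map_pullback\<close> then covers all polynomials.\<close>

definition poly_map :: "('p \<Rightarrow> complex) set \<Rightarrow> ('q \<Rightarrow> complex) set \<Rightarrow> ('p \<Rightarrow> 'q) \<Rightarrow> bool" where
  "poly_map C D \<phi> \<longleftrightarrow> (\<forall>f\<in>D. (\<lambda>p. f (\<phi> p)) \<in> poly_functions C)"

lemma poly_map_pullback:
  assumes "poly_map C D \<phi>" "f \<in> poly_functions D"
  shows "(\<lambda>p. f (\<phi> p)) \<in> poly_functions C"
  using assms(2)
  by induction (use assms(1) in \<open>auto simp: poly_map_def intro: poly_functions.intros\<close>)

text \<open>Principal open sets form a basis of the topology, so a neighbourhood can be traded for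
  the nonvanishing locus of one polynomial.\<close>

lemma openin_zariskiE:
  assumes "openin (zariski C X) V" "x \<in> V"
  obtains f where "f \<in> poly_functions C" "f x \<noteq> 0" "\<And>y. y \<in> X \<Longrightarrow> f y \<noteq> 0 \<Longrightarrow> y \<in> V"
proof -
  obtain S where S: "S \<subseteq> poly_functions C" "V = X - {p \<in> X. \<forall>f\<in>S. f p = 0}"
    using assms(1) unfolding openin_zariski by blast
  then obtain f where "f \<in> S" "f x \<noteq> 0" using assms(2) by blast
  then show thesis using S by (intro that[of f]) auto
qed

lemma openin_zariskiI:
  assumes "V \<subseteq> X"
    and "\<And>x. x \<in> V \<Longrightarrow> \<exists>f\<in>poly_functions C. f x \<noteq> 0 \<and> (\<forall>y\<in>X. f y \<noteq> 0 \<longrightarrow> y \<in> V)"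
  shows "openin (zariski C X) V"
  unfolding openin_zariski
proof (intro exI conjI)
  \<comment> \<open>The largest possible family: all polynomials whose nonvanishing locus in
    \<open>X\<close> stays inside \<open>V\<close>.\<close>
  let ?S = "{f \<in> poly_functions C. \<forall>y\<in>X. f y \<noteq> 0 \<longrightarrow> y \<in> V}"
  show "?S \<subseteq> poly_functions C" by blast
  show "V = X - {p \<in> X. \<forall>f\<in>?S. f p = 0}"
  proof (intro equalityI subsetI)
    fix x assume "x \<in> V"
    with assms(2)[OF this] assms(1) show "x \<in> X - {p \<in> X. \<forall>f\<in>?S. f p = 0}" by auto
  qed auto
qed

lemma openin_zariski_principal:
  "f \<in> poly_functions C \<Longrightarrow> openin (zariski C X) {x \<in> X. f x \<noteq> 0}"
  by (rule openin_zariskiI) auto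

lemma continuous_map_zariski:
  assumes "poly_map C D \<phi>" "\<phi> ` X \<subseteq> Y"
  shows "continuous_map (zariski C X) (zariski D Y) \<phi>"
  unfolding continuous_map_def topspace_zariski
proof (intro conjI allI impI)
  show "\<phi> \<in> X \<rightarrow> Y" using assms(2) by blast
  fix V assume V: "openin (zariski D Y) V"
  show "openin (zariski C X) {x \<in> X. \<phi> x \<in> V}"
  proof (rule openin_zariskiI)
    fix x assume "x \<in> {x \<in> X. \<phi> x \<in> V}"
    then obtain f where f: "f \<in> poly_functions D" "f (\<phi> x) \<noteq> 0"
      "\<And>y. y \<in> Y \<Longrightarrow> f y \<noteq> 0 \<Longrightarrow> y \<in> V"
      using openin_zariskiE[OF V] by blast
    then show "\<exists>f\<in>poly_functions C. f x \<noteq> 0 \<and> (\<forall>y\<in>X. f y \<noteq> 0 \<longrightarrow> y \<in> {x \<in> X. \<phi> x \<in> V})"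
      using poly_map_pullback[OF assms(1) f(1)] assms(2)
      by (intro bexI[of _ "\<lambda>x. f (\<phi> x)"]) auto
  qed auto
qed

text \<open>Only principal neighbourhoods have to meet \<open>Z\<close>, so density becomes a
  statement about single polynomials.\<close>

lemma in_closure_of_zariski:
  "x \<in> zariski C R closure_of Z \<longleftrightarrow>
     x \<in> R \<and> (\<forall>f\<in>poly_functions C. f x \<noteq> 0 \<longrightarrow> (\<exists>y\<in>Z \<inter> R. f y \<noteq> 0))"
proof (intro iffI conjI ballI impI)
  assume x: "x \<in> zariski C R closure_of Z"
  then show "x \<in> R" by (simp add: in_closure_of topspace_zariski)
  fix f assume "f \<in> poly_functions C" "f x \<noteq> 0"
  then show "\<exists>y\<in>Z \<inter> R. f y \<noteq> 0"
    using x \<open>x \<in> R\<close> openin_zariski_principal[of f C R] unfolding in_closure_of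
    by (elim conjE allE[of _ "{y \<in> R. f y \<noteq> 0}"]) auto
next
  assume x: "x \<in> R \<and> (\<forall>f\<in>poly_functions C. f x \<noteq> 0 \<longrightarrow> (\<exists>y\<in>Z \<inter> R. f y \<noteq> 0))"
  show "x \<in> zariski C R closure_of Z"
    unfolding in_closure_of topspace_zariski
  proof (intro conjI allI impI)
    fix T assume T: "x \<in> T \<and> openin (zariski C R) T"
    then obtain f where "f \<in> poly_functions C" "f x \<noteq> 0" "\<And>y. y \<in> R \<Longrightarrow> f y \<noteq> 0 \<Longrightarrow> y \<in> T"
      using openin_zariskiE[of C R T x] by blast
    then show "\<exists>y. y \<in> Z \<and> y \<in> T" using x by blast
  qed (use x in blast)
qed

lemma regular_functionsI:
  assumes "f \<in> extensional X"
    and "\<And>x. x \<in> X \<Longrightarrow> \<exists>V a b. openin (zariski C X) V \<and> x \<in> V \<and>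
       a \<in> poly_functions C \<and> b \<in> poly_functions C \<and> (\<forall>y\<in>V. b y \<noteq> 0 \<and> f y = a y / b y)"
  shows "f \<in> regular_functions C X"
  using assms unfolding regular_functions_def by blast

lemma regular_functionsE:
  assumes "f \<in> regular_functions C X" "x \<in> X"
  obtains V a b where "openin (zariski C X) V" "x \<in> V"
    "a \<in> poly_functions C" "b \<in> poly_functions C" "\<And>y. y \<in> V \<Longrightarrow> b y \<noteq> 0"
    "\<And>y. y \<in> V \<Longrightarrow> f y = a y / b y"
  using assms unfolding regular_functions_def by blast

lemma regular_functions_extensional: "f \<in> regular_functions C X \<Longrightarrow> f \<in> extensional X"
  unfolding regular_functions_def by blast

lemma regular_functions_quotient:
  assumes "a \<in> poly_functions C" "b \<in> poly_functions C" "\<And>x. x \<in> X \<Longrightarrow> b x \<noteq> 0"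
  shows "(\<lambda>x\<in>X. a x / b x) \<in> regular_functions C X"
proof (rule regular_functionsI)
  fix x assume "x \<in> X"
  then show "\<exists>V a' b'. openin (zariski C X) V \<and> x \<in> V \<and>
       a' \<in> poly_functions C \<and> b' \<in> poly_functions C \<and>
       (\<forall>y\<in>V. b' y \<noteq> 0 \<and> (\<lambda>x\<in>X. a x / b x) y = a' y / b' y)"
    using assms openin_topspace[of "zariski C X"]
    by (intro exI[of _ X] exI[of _ a] exI[of _ b]) (auto simp: topspace_zariski)
qed auto

lemma regular_functions_poly:
  assumes "a \<in> poly_functions C" shows "(\<lambda>x\<in>X. a x) \<in> regular_functions C X"
  using regular_functions_quotient[OF assms poly_functions.const[of 1], of X] by simp

lemma regular_functions_add_mult:
  assumes f: "f \<in> regular_functions C X" and g: "g \<in> regular_functions C X"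
  shows regular_functions_add: "(\<lambda>x\<in>X. f x + g x) \<in> regular_functions C X"
    and regular_functions_mult: "(\<lambda>x\<in>X. f x * g x) \<in> regular_functions C X"
proof -
  \<comment> \<open>Both functions become fractions on one common neighbourhood; the sum and the
    product share this preparation.\<close>
  have "\<exists>V a b a' b'. openin (zariski C X) V \<and> x \<in> V \<and> {a, b, a', b'} \<subseteq> poly_functions C \<and>
      (\<forall>y\<in>V. y \<in> X \<and> b y \<noteq> 0 \<and> b' y \<noteq> 0 \<and> f y = a y / b y \<and> g y = a' y / b' y)"
    if "x \<in> X" for x
  proof -
    obtain V a b where 1: "openin (zariski C X) V" "x \<in> V" "a \<in> poly_functions C"
      "b \<in> poly_functions C" "\<And>y. y \<in> V \<Longrightarrow> b y \<noteq> 0" "\<And>y. y \<in> V \<Longrightarrow> f y = a y / b y"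
      using regular_functionsE[OF f \<open>x \<in> X\<close>] by blast
    obtain V' a' b' where 2: "openin (zariski C X) V'" "x \<in> V'" "a' \<in> poly_functions C"
      "b' \<in> poly_functions C" "\<And>y. y \<in> V' \<Longrightarrow> b' y \<noteq> 0" "\<And>y. y \<in> V' \<Longrightarrow> g y = a' y / b' y"
      using regular_functionsE[OF g \<open>x \<in> X\<close>] by blast
    have "V \<subseteq> X" using openin_subset[OF 1(1)] by (simp add: topspace_zariski)
    then show ?thesis
      using 1 2 by (intro exI[of _ "V \<inter> V'"] exI[of _ a] exI[of _ b] exI[of _ a'] exI[of _ b'])
        auto
  qed
  note local = this
  show "(\<lambda>x\<in>X. f x + g x) \<in> regular_functions C X"
  proof (rule regular_functionsI)
    fix x assume "x \<in> X"
    then obtain V a b a' b' where "openin (zariski C X) V" "x \<in> V"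
      "{a, b, a', b'} \<subseteq> poly_functions C"
      "\<forall>y\<in>V. y \<in> X \<and> b y \<noteq> 0 \<and> b' y \<noteq> 0 \<and> f y = a y / b y \<and> g y = a' y / b' y"
      using local[OF \<open>x \<in> X\<close>] by (elim exE conjE) (rule that)
    then show "\<exists>V a b. openin (zariski C X) V \<and> x \<in> V \<and>
       a \<in> poly_functions C \<and> b \<in> poly_functions C \<and>
       (\<forall>y\<in>V. b y \<noteq> 0 \<and> (\<lambda>x\<in>X. f x + g x) y = a y / b y)"
      by (intro exI[of _ V] exI[of _ "\<lambda>p. a p * b' p + a' p * b p"] exI[of _ "\<lambda>p. b p * b' p"])
        (auto intro!: poly_functions.add poly_functions.mult simp: field_simps)
  qed auto
  show "(\<lambda>x\<in>X. f x * g x) \<in> regular_functions C X"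
  proof (rule regular_functionsI)
    fix x assume "x \<in> X"
    then obtain V a b a' b' where "openin (zariski C X) V" "x \<in> V"
      "{a, b, a', b'} \<subseteq> poly_functions C"
      "\<forall>y\<in>V. y \<in> X \<and> b y \<noteq> 0 \<and> b' y \<noteq> 0 \<and> f y = a y / b y \<and> g y = a' y / b' y"
      using local[OF \<open>x \<in> X\<close>] by (elim exE conjE) (rule that)
    then show "\<exists>V a b. openin (zariski C X) V \<and> x \<in> V \<and>
       a \<in> poly_functions C \<and> b \<in> poly_functions C \<and>
       (\<forall>y\<in>V. b y \<noteq> 0 \<and> (\<lambda>x\<in>X. f x * g x) y = a y / b y)"
      by (intro exI[of _ V] exI[of _ "\<lambda>p. a p * a' p"] exI[of _ "\<lambda>p. b p * b' p"])
        (auto intro!: poly_functions.mult)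
  qed auto
qed

lemma regular_functions_pullback:
  assumes "poly_map C D \<phi>" "\<phi> ` X \<subseteq> Y" "f \<in> regular_functions D Y"
  shows "(\<lambda>x\<in>X. f (\<phi> x)) \<in> regular_functions C X"
proof (rule regular_functionsI)
  fix x assume x: "x \<in> X"
  then have "\<phi> x \<in> Y" using assms(2) by blast
  from regular_functionsE[OF assms(3) this] obtain V a b where
    V: "openin (zariski D Y) V" "\<phi> x \<in> V" "a \<in> poly_functions D" "b \<in> poly_functions D"
      "\<And>y. y \<in> V \<Longrightarrow> b y \<noteq> 0" "\<And>y. y \<in> V \<Longrightarrow> f y = a y / b y"
    by blast
  have "openin (zariski C X) {x \<in> X. \<phi> x \<in> V}"
    using continuous_map_zariski[OF assms(1,2)] V(1)
    by (auto simp: continuous_map_def topspace_zariski)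
  then show "\<exists>V a b. openin (zariski C X) V \<and> x \<in> V \<and>
       a \<in> poly_functions C \<and> b \<in> poly_functions C \<and>
       (\<forall>y\<in>V. b y \<noteq> 0 \<and> (\<lambda>x\<in>X. f (\<phi> x)) y = a y / b y)"
    using V x poly_map_pullback[OF assms(1) V(3)] poly_map_pullback[OF assms(1) V(4)]
    by (intro exI[of _ "{x \<in> X. \<phi> x \<in> V}"] exI[of _ "\<lambda>x. a (\<phi> x)"] exI[of _ "\<lambda>x. b (\<phi> x)"]) auto
qed auto

text \<open>If \<open>f\<close> and \<open>g\<close> differed at \<open>x\<close>, a polynomial
  expressing this would be nonzero at \<open>x\<close>, hence by density at some point of
  \<open>Z\<close>, where \<open>f\<close> and \<open>g\<close> agree.\<close>

lemma regular_functions_eq_on_closure: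
  assumes f: "f \<in> regular_functions C X" and g: "g \<in> regular_functions C X"
    and X: "X \<subseteq> zariski C R closure_of Z" and "Z \<subseteq> X"
    and eq: "\<And>x. x \<in> Z \<Longrightarrow> f x = g x"
  shows "f = g"
proof
  fix x show "f x = g x"
  proof (cases "x \<in> X")
    case False
    then show ?thesis
      using f g[THEN regular_functions_extensional] regular_functions_extensional
      by (metis extensional_arb)
  next
    case True
    obtain V a b where 1: "openin (zariski C X) V" "x \<in> V" "a \<in> poly_functions C"
      "b \<in> poly_functions C" "\<And>y. y \<in> V \<Longrightarrow> b y \<noteq> 0" "\<And>y. y \<in> V \<Longrightarrow> f y = a y / b y"
      using regular_functionsE[OF f True] by blast
    obtain V' a' b' where 2: "openin (zariski C X) V'" "x \<in> V'" "a' \<in> poly_functions C"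
      "b' \<in> poly_functions C" "\<And>y. y \<in> V' \<Longrightarrow> b' y \<noteq> 0" "\<And>y. y \<in> V' \<Longrightarrow> g y = a' y / b' y"
      using regular_functionsE[OF g True] by blast
    obtain k where k: "k \<in> poly_functions C" "k x \<noteq> 0" "\<And>y. y \<in> X \<Longrightarrow> k y \<noteq> 0 \<Longrightarrow> y \<in> V"
      using openin_zariskiE[OF 1(1,2)] by blast
    obtain k' where k': "k' \<in> poly_functions C" "k' x \<noteq> 0" "\<And>y. y \<in> X \<Longrightarrow> k' y \<noteq> 0 \<Longrightarrow> y \<in> V'"
      using openin_zariskiE[OF 2(1,2)] by blast
    \<comment> \<open>The first factor is the numerator of the difference of the two fractions. The
      factors \<open>k\<close> and \<open>k'\<close> make \<open>d\<close> vanish at the points of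
      \<open>X\<close> outside \<open>V \<inter> V'\<close>, where the fractions may fail to
      represent \<open>f\<close> and \<open>g\<close>.\<close>
    define d where "d = (\<lambda>p. (a p * b' p - a' p * b p) * (k p * k' p))"
    have d: "d \<in> poly_functions C"
      unfolding d_def by (intro poly_functions.mult poly_functions_diff 1 2 k k')
    show ?thesis
    proof (rule ccontr)
      assume "f x \<noteq> g x"
      then have "d x \<noteq> 0" using 1 2 k k' by (auto simp: d_def frac_eq_eq)
      moreover have "x \<in> zariski C R closure_of Z" using X True by blast
      ultimately obtain y where y: "y \<in> Z" "d y \<noteq> 0"
        using d unfolding in_closure_of_zariski by blast
      then have "y \<in> V" "y \<in> V'" using k k' \<open>Z \<subseteq> X\<close> by (auto simp: d_def)
      then show False using 1 2 y eq[OF y(1)] by (auto simp: d_def frac_eq_eq)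
    qed
  qed
qed

section \<open>Characters of principal open sets of affine space\<close>

text \<open>The values on the coordinates single out the only candidate point, and \<open>h\<close>
  is nonzero there because a character sends a unit to a nonzero number. With \<open>h = 1\<close>
  this covers the whole affine space.\<close>

lemma algebra_characters_affine:
  fixes h :: "complex ^ 'n \<Rightarrow> complex"
  assumes h: "h \<in> poly_functions affine_coords"
    and \<xi>: "\<xi> \<in> algebra_characters {z. h z \<noteq> 0} (regular_functions affine_coords {z. h z \<noteq> 0})"
  shows "\<exists>z. h z \<noteq> 0 \<and> (\<forall>g\<in>regular_functions affine_coords {z. h z \<noteq> 0}. \<xi> g = g z)"
proof -
  define Y where "Y = {z. h z \<noteq> 0}"
  let ?C = "affine_coords :: (complex ^ 'n \<Rightarrow> complex) set"
  let ?A = "regular_functions ?C Y"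
  have \<xi>_const: "\<xi> (\<lambda>y\<in>Y. c) = c" for c
    using \<xi> by (simp add: algebra_characters_def Y_def)
  have \<xi>_add: "\<xi> (\<lambda>y\<in>Y. f y + g y) = \<xi> f + \<xi> g" if "f \<in> ?A" "g \<in> ?A" for f g
    using \<xi> that by (simp add: algebra_characters_def Y_def)
  have \<xi>_mult: "\<xi> (\<lambda>y\<in>Y. f y * g y) = \<xi> f * \<xi> g" if "f \<in> ?A" "g \<in> ?A" for f g
    using \<xi> that by (simp add: algebra_characters_def Y_def)
  define z where "z = (\<chi> i. \<xi> (\<lambda>y\<in>Y. y $ i))"
  have \<xi>_poly: "\<xi> (\<lambda>y\<in>Y. a y) = a z" if "a \<in> poly_functions ?C" for a
    using that
  proof induction
    case (const c)
    then show ?case by (rule \<xi>_const)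
  next
    case (coord f)
    then show ?case by (auto simp: affine_coords_def z_def restrict_def)
  next
    case (add f g)
    have "\<xi> (\<lambda>y\<in>Y. f y + g y) = \<xi> (\<lambda>y\<in>Y. (\<lambda>y\<in>Y. f y) y + (\<lambda>y\<in>Y. g y) y)"
      by (rule arg_cong[of _ _ \<xi>]) auto
    with add show ?case by (simp only: \<xi>_add regular_functions_poly)
  next
    case (mult f g)
    have "\<xi> (\<lambda>y\<in>Y. f y * g y) = \<xi> (\<lambda>y\<in>Y. (\<lambda>y\<in>Y. f y) y * (\<lambda>y\<in>Y. g y) y)"
      by (rule arg_cong[of _ _ \<xi>]) auto
    with mult show ?case by (simp only: \<xi>_mult regular_functions_poly)
  qed
  have inv: "(\<lambda>y\<in>Y. 1 / h y) \<in> ?A"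
    by (rule regular_functions_quotient[OF poly_functions.const h]) (simp add: Y_def)
  have "1 = \<xi> (\<lambda>y\<in>Y. 1)" by (simp only: \<xi>_const)
  also have "\<dots> = \<xi> (\<lambda>y\<in>Y. (\<lambda>y\<in>Y. h y) y * (\<lambda>y\<in>Y. 1 / h y) y)"
    by (rule arg_cong[of _ _ \<xi>]) (auto simp: Y_def)
  also have "\<dots> = h z * \<xi> (\<lambda>y\<in>Y. 1 / h y)"
    using \<xi>_mult[OF regular_functions_poly[OF h] inv] \<xi>_poly[OF h] by simp
  finally have hz: "h z \<noteq> 0" by auto
  moreover have "\<xi> g = g z" if g: "g \<in> ?A" for g
  proof -
    have "z \<in> Y" using hz by (simp add: Y_def)
    then obtain V a b where V: "openin (zariski ?C Y) V" "z \<in> V" "a \<in> poly_functions ?C"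
      "b \<in> poly_functions ?C" "\<And>y. y \<in> V \<Longrightarrow> b y \<noteq> 0" "\<And>y. y \<in> V \<Longrightarrow> g y = a y / b y"
      using regular_functionsE[OF g] by blast
    obtain k where k: "k \<in> poly_functions ?C" "k z \<noteq> 0" "\<And>y. y \<in> Y \<Longrightarrow> k y \<noteq> 0 \<Longrightarrow> y \<in> V"
      using openin_zariskiE[OF V(1,2)] by blast
    have kb: "(\<lambda>y. k y * b y) \<in> poly_functions ?C" and ka: "(\<lambda>y. k y * a y) \<in> poly_functions ?C"
      using k V by (auto intro: poly_functions.mult)
    \<comment> \<open>Clearing the local denominator globally: \<open>k * b * g = k * a\<close>
      holds on all of \<open>Y\<close>, inside \<open>V\<close> by the fraction and outside because
      \<open>k\<close> vanishes there.\<close>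
    have "k z * b z * \<xi> g = \<xi> (\<lambda>y\<in>Y. (\<lambda>y\<in>Y. k y * b y) y * g y)"
      using \<xi>_mult[OF regular_functions_poly[OF kb] g] \<xi>_poly[OF kb] by simp
    also have "\<dots> = \<xi> (\<lambda>y\<in>Y. k y * a y)"
      by (rule arg_cong[of _ _ \<xi>]) (use V k in \<open>force simp: restrict_def\<close>)
    also have "\<dots> = k z * a z" by (rule \<xi>_poly[OF ka])
    finally have "b z * \<xi> g = b z * g z" using k(2) V(5,6)[OF V(2)] by simp
    then show ?thesis using V(5)[OF V(2)] by simp
  qed
  ultimately show ?thesis unfolding Y_def by blast
qed

section \<open>Quotients with a section\<close>

text \<open>If \<open>\<pi>\<close> is invariant with section \<open>\<sigma>\<close>, and an invariant function is determined by its
  values on the section, then composing with \<open>\<pi>\<close> and with \<open>\<sigma>\<close> identifies the invariants with the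
  functions on \<open>Y\<close>; characters of the latter are assumed to be evaluations.\<close>

lemma GIT_quotient_isomorphic_section:
  assumes \<pi>: "poly_map C D \<pi>" "\<pi> ` X \<subseteq> Y" and \<sigma>: "poly_map D C \<sigma>" "\<sigma> ` Y \<subseteq> X"
    and \<pi>\<sigma>: "\<And>y. y \<in> Y \<Longrightarrow> \<pi> (\<sigma> y) = y"
    and act: "\<And>g p. g \<in> carrier G \<Longrightarrow> p \<in> X \<Longrightarrow> act g p \<in> X \<and> \<pi> (act g p) = \<pi> p"
    and inv: "\<And>f p. f \<in> invariant_functions G act (subvariety C X) \<Longrightarrow> p \<in> X \<Longrightarrow> f (\<sigma> (\<pi> p)) = f p"
    and chars: "\<And>\<xi>. \<xi> \<in> algebra_characters Y (regular_functions D Y) \<Longrightarrow>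
                  \<exists>y\<in>Y. \<forall>g\<in>regular_functions D Y. \<xi> g = g y"
    and sep: "\<And>y y'. y \<in> Y \<Longrightarrow> y' \<in> Y \<Longrightarrow> (\<And>f. f \<in> D \<Longrightarrow> f y = f y') \<Longrightarrow> y = y'"
  shows "variety_isomorphic (GIT_quotient G act (subvariety C X)) (subvariety D Y)"
proof -
  define A where "A = invariant_functions G act (subvariety C X)"
  define B where "B = regular_functions D Y"
  define P where "P = algebra_characters X A"
  have A: "f \<in> A \<longleftrightarrow> f \<in> regular_functions C X \<and> (\<forall>g\<in>carrier G. \<forall>p\<in>X. f (act g p) = f p)" for f
    by (auto simp: A_def invariant_functions_def subvariety_def)
  have Q: "GIT_quotient G act (subvariety C X) = \<lparr>points = P, regular = (\<lambda>f. \<lambda>\<xi>\<in>P. \<xi> f) ` A\<rparr>"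
    by (simp add: GIT_quotient_def Let_def A_def P_def subvariety_def)
  have lift: "(\<lambda>x\<in>X. g (\<pi> x)) \<in> A" if "g \<in> B" for g
    using regular_functions_pullback[OF \<pi>] that act by (auto simp: A B_def)
  have lower: "(\<lambda>y\<in>Y. f (\<sigma> y)) \<in> B" if "f \<in> A" for f
    using regular_functions_pullback[OF \<sigma>] that by (auto simp: A B_def)
  have \<sigma>Y: "\<sigma> y \<in> X" if "y \<in> Y" for y using \<sigma>(2) that by blast
  have \<pi>X: "\<pi> x \<in> Y" if "x \<in> X" for x using \<pi>(2) that by blast
  have lift_lower: "(\<lambda>x\<in>X. (\<lambda>y\<in>Y. f (\<sigma> y)) (\<pi> x)) = f" if "f \<in> A" for f
  proof
    have "f \<in> extensional X" using that by (auto simp: A regular_functions_extensional)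
    then show "(\<lambda>x\<in>X. (\<lambda>y\<in>Y. f (\<sigma> y)) (\<pi> x)) x = f x" for x
      using inv[folded A_def, OF that] \<pi>X by (auto simp: extensional_def)
  qed
  have A_const: "(\<lambda>p\<in>X. c) \<in> A" for c
    using regular_functions_poly[OF poly_functions.const] act by (auto simp: A)
  have A_add: "(\<lambda>p\<in>X. f p + g p) \<in> A" and A_mult: "(\<lambda>p\<in>X. f p * g p) \<in> A"
    if "f \<in> A" "g \<in> A" for f g
    using that act regular_functions_add regular_functions_mult by (auto simp: A)
  \<comment> \<open>Each point of \<open>Y\<close> gives a character of the invariants through the
    section; \<open>k\<close> will turn out to be a bijection onto all characters.\<close>
  define k where "k y = (\<lambda>f\<in>A. f (\<sigma> y))" for y
  have kP: "k y \<in> P" if "y \<in> Y" for y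
    using that A_const A_add A_mult \<sigma>Y by (auto simp: P_def algebra_characters_def k_def)
  have "inj_on k Y"
  proof (rule inj_onI)
    fix y y' assume y: "y \<in> Y" "y' \<in> Y" and eq: "k y = k y'"
    show "y = y'"
    proof (rule sep[OF y])
      fix f assume "f \<in> D"
      then have "(\<lambda>y\<in>Y. f y) \<in> B"
        unfolding B_def by (intro regular_functions_poly poly_functions.coord)
      from fun_cong[OF eq, of "\<lambda>x\<in>X. (\<lambda>y\<in>Y. f y) (\<pi> x)"] lift[OF this] show "f y = f y'"
        using y \<sigma>Y \<pi>\<sigma> by (simp add: k_def)
    qed
  qed
  moreover have "k ` Y = P"
  proof
    show "P \<subseteq> k ` Y"
    proof
      fix \<xi> assume \<xi>: "\<xi> \<in> P"
      \<comment> \<open>Composition with \<open>\<pi>\<close> maps \<open>B\<close> into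
        \<open>A\<close>, so \<open>\<xi>\<close> restricts to a character of \<open>B\<close>, to
        which \<open>chars\<close> applies.\<close>
      define \<eta> where "\<eta> = (\<lambda>g\<in>B. \<xi> (\<lambda>x\<in>X. g (\<pi> x)))"
      have "\<eta> \<in> algebra_characters Y B"
        unfolding algebra_characters_def
      proof (intro CollectI conjI ballI allI)
        have "(\<lambda>x\<in>X. (\<lambda>y\<in>Y. c) (\<pi> x)) = (\<lambda>x\<in>X. c)" for c :: complex using \<pi>X by auto
        moreover have "(\<lambda>y\<in>Y. c) \<in> regular_functions D Y" for c
          by (intro regular_functions_poly poly_functions.const)
        ultimately show "\<eta> (\<lambda>y\<in>Y. c) = c" for c
          using \<xi>
          by (simp add: \<eta>_def B_def P_def algebra_characters_def)
        fix f g assume fg: "f \<in> B" "g \<in> B"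
        have "(\<lambda>x\<in>X. (\<lambda>y\<in>Y. f y + g y) (\<pi> x)) =
            (\<lambda>x\<in>X. (\<lambda>x\<in>X. f (\<pi> x)) x + (\<lambda>x\<in>X. g (\<pi> x)) x)"
          using \<pi>X by auto
        then show "\<eta> (\<lambda>y\<in>Y. f y + g y) = \<eta> f + \<eta> g"
          using \<xi> lift[OF fg(1)] lift[OF fg(2)] fg regular_functions_add[of f D Y g]
          by (simp only: \<eta>_def B_def P_def algebra_characters_def restrict_apply' mem_Collect_eq)
        have "(\<lambda>x\<in>X. (\<lambda>y\<in>Y. f y * g y) (\<pi> x)) =
            (\<lambda>x\<in>X. (\<lambda>x\<in>X. f (\<pi> x)) x * (\<lambda>x\<in>X. g (\<pi> x)) x)"
          using \<pi>X by auto
        then show "\<eta> (\<lambda>y\<in>Y. f y * g y) = \<eta> f * \<eta> g"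
          using \<xi> lift[OF fg(1)] lift[OF fg(2)] fg regular_functions_mult[of f D Y g]
          by (simp only: \<eta>_def B_def P_def algebra_characters_def restrict_apply' mem_Collect_eq)
      qed (auto simp: \<eta>_def)
      then obtain y where y: "y \<in> Y" "\<And>g. g \<in> B \<Longrightarrow> \<eta> g = g y"
        using chars unfolding B_def by blast
      have "\<xi> f = k y f" for f
      proof (cases "f \<in> A")
        case True
        then have "\<xi> f = \<eta> (\<lambda>y\<in>Y. f (\<sigma> y))"
          using lower lift_lower by (simp add: \<eta>_def)
        then show ?thesis using y lower True by (simp add: k_def)
      next
        case False
        then show ?thesis
          using \<xi> by (auto simp: k_def P_def algebra_characters_def extensional_def)
      qed
      then have "\<xi> = k y" by blast
      then show "\<xi> \<in> k ` Y" using y by blast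
    qed
  qed (use kP in blast)
  ultimately have k: "bij_betw k Y P" by (simp add: bij_betw_def)
  define h where "h = inv_into Y k"
  have h: "bij_betw h P Y" unfolding h_def by (rule bij_betw_inv_into[OF k])
  have hP: "h \<xi> \<in> Y" "\<xi> = k (h \<xi>)" if "\<xi> \<in> P" for \<xi>
    using that h k by (auto simp: h_def bij_betw_inv_into_right dest: bij_betwE)
  have eval: "\<xi> f = f (\<sigma> (h \<xi>))" if "\<xi> \<in> P" "f \<in> A" for \<xi> f
    using hP(2)[OF that(1)] that(2) unfolding k_def by (metis restrict_apply')
  have "(\<lambda>f. \<lambda>\<xi>\<in>P. \<xi> f) ` A = (\<lambda>g. restrict (g \<circ> h) P) ` B"
  proof (intro equalityI subsetI)
    fix F assume "F \<in> (\<lambda>f. \<lambda>\<xi>\<in>P. \<xi> f) ` A"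
    then obtain f where f: "f \<in> A" "F = (\<lambda>\<xi>\<in>P. \<xi> f)" by blast
    have "F = restrict ((\<lambda>y\<in>Y. f (\<sigma> y)) \<circ> h) P"
      unfolding f(2) using hP(1) eval[OF _ f(1)] by (auto simp: restrict_def)
    then show "F \<in> (\<lambda>g. restrict (g \<circ> h) P) ` B" using lower[OF f(1)] by blast
  next
    fix F assume "F \<in> (\<lambda>g. restrict (g \<circ> h) P) ` B"
    then obtain g where g: "g \<in> B" "F = restrict (g \<circ> h) P" by blast
    have "F = (\<lambda>\<xi>\<in>P. \<xi> (\<lambda>x\<in>X. g (\<pi> x)))"
      unfolding g(2) using hP(1) \<sigma>Y \<pi>\<sigma> eval[OF _ lift[OF g(1)]] by (auto simp: restrict_def)
    then show "F \<in> (\<lambda>f. \<lambda>\<xi>\<in>P. \<xi> f) ` A" using lift[OF g(1)] by blast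
  qed
  with h have "variety_isomorphic \<lparr>points = P, regular = (\<lambda>f. \<lambda>\<xi>\<in>P. \<xi> f) ` A\<rparr> (subvariety D Y)"
    unfolding variety_isomorphic_def subvariety_def variety.simps B_def by blast
  then show ?thesis by (simp only: Q)
qed

section \<open>Homomorphisms from presented groups\<close>

text \<open>A word grows letter by letter on the left, and a negative letter acts as the group
  inverse of its generator.\<close>

lemma presented_group_induct [consumes 1, case_names one gen inv]:
  assumes "U \<in> carrier (presented_group Rel)"
    and one: "P \<one>\<^bsub>presented_group Rel\<^esub>"
    and gen: "\<And>g U. U \<in> carrier (presented_group Rel) \<Longrightarrow> P U \<Longrightarrow>
      P (word_class Rel [(g, True)] \<otimes>\<^bsub>presented_group Rel\<^esub> U)"
    and inv: "\<And>g U. U \<in> carrier (presented_group Rel) \<Longrightarrow> P U \<Longrightarrow>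
      P (inv\<^bsub>presented_group Rel\<^esub> (word_class Rel [(g, True)]) \<otimes>\<^bsub>presented_group Rel\<^esub> U)"
  shows "P U"
proof -
  interpret group "presented_group Rel" by (rule group_presented_group)
  have carr: "word_class Rel u \<in> carrier (presented_group Rel)" for u
    by (simp add: presented_group_def)
  have neg: "inv\<^bsub>presented_group Rel\<^esub> (word_class Rel [(g, True)]) = word_class Rel [(g, False)]"
    for g
  proof (rule inv_equality[OF _ carr carr])
    have "word_equiv Rel [(g, False), (g, True)] []"
      using word_equiv.cancel[of Rel "[]" g False "[]"] by simp
    moreover have "\<one>\<^bsub>presented_group Rel\<^esub> = word_class Rel []"
      by (simp add: presented_group_def)
    ultimately show "word_class Rel [(g, False)] \<otimes>\<^bsub>presented_group Rel\<^esub> word_class Rel [(g, True)]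
        = \<one>\<^bsub>presented_group Rel\<^esub>"
      by (simp add: word_class_mult word_class_eq_iff)
  qed
  have "P (word_class Rel u)" for u
  proof (induction u)
    case Nil
    then show ?case using one by (simp add: presented_group_def)
  next
    case (Cons a u)
    obtain g b where a: "a = (g, b)" by (cases a)
    show ?case
      using gen[OF carr Cons, of g] inv[OF carr Cons, of g]
      by (cases b) (simp_all add: a neg word_class_mult)
  qed
  then show ?thesis using assms(1) by (auto simp: presented_group_def)
qed

primrec word_eval :: "('a, 'm) monoid_scheme \<Rightarrow> ('g \<Rightarrow> 'a) \<Rightarrow> 'g word \<Rightarrow> 'a" where
  "word_eval G a [] = \<one>\<^bsub>G\<^esub>"
| "word_eval G a (x # w) = (if snd x then a (fst x) else inv\<^bsub>G\<^esub> a (fst x)) \<otimes>\<^bsub>G\<^esub> word_eval G a w"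

text \<open>Von Dyck's theorem: the value of a word is unchanged by each generating move of
  \<open>word_equiv\<close>, so evaluation descends to classes.\<close>

lemma presented_group_universal:
  assumes "group G" and a: "range a \<subseteq> carrier G"
    and rel: "\<And>l r. (l, r) \<in> Rel \<Longrightarrow> word_eval G a l = word_eval G a r"
  obtains \<rho> where "\<rho> \<in> hom (presented_group Rel) G" "\<rho> \<in> extensional (carrier (presented_group Rel))"
    "\<And>g. \<rho> (word_class Rel [(g, True)]) = a g"
proof -
  interpret group G by fact
  let ?ev = "word_eval G a"
  have a': "a g \<in> carrier G" for g using a by blast
  have ev: "?ev u \<in> carrier G" for u
    by (induction u) (auto simp: a')
  have ev_append: "?ev (u @ v) = ?ev u \<otimes>\<^bsub>G\<^esub> ?ev v" for u v
    by (induction u) (auto simp: a' ev m_assoc)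
  have ev_equiv: "?ev u = ?ev v" if "word_equiv Rel u v" for u v
    using that
  proof induction
    case (cancel u g b v)
    then show ?case by (cases b) (auto simp: ev_append a' ev m_assoc[symmetric])
  qed (auto simp: ev_append rel)
  \<comment> \<open>Any representative will do, since equivalent words have the same value by
    \<open>ev_equiv\<close>.\<close>
  define \<rho> where "\<rho> = (\<lambda>U\<in>carrier (presented_group Rel). ?ev (SOME u. u \<in> U))"
  have \<rho>: "\<rho> (word_class Rel u) = ?ev u" for u
  proof -
    have "(SOME v. v \<in> word_class Rel u) \<in> word_class Rel u"
      by (rule someI[of _ u]) (simp add: word_class_def word_equiv.refl)
    then have "?ev u = ?ev (SOME v. v \<in> word_class Rel u)"
      by (intro ev_equiv) (simp add: word_class_def)
    then show ?thesis by (simp add: \<rho>_def presented_group_def)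
  qed
  show thesis
  proof
    show "\<rho> \<in> hom (presented_group Rel) G"
    proof (rule homI)
      fix U V assume "U \<in> carrier (presented_group Rel)" "V \<in> carrier (presented_group Rel)"
      then obtain u v where "U = word_class Rel u" "V = word_class Rel v"
        by (auto simp: presented_group_def)
      then show "\<rho> U \<in> carrier G"
        "\<rho> (U \<otimes>\<^bsub>presented_group Rel\<^esub> V) = \<rho> U \<otimes>\<^bsub>G\<^esub> \<rho> V"
        by (simp_all add: \<rho> ev word_class_mult ev_append)
    qed
    show "\<rho> \<in> extensional (carrier (presented_group Rel))" by (simp add: \<rho>_def)
    show "\<rho> (word_class Rel [(g, True)]) = a g" for g by (simp add: \<rho> a')
  qed
qed

lemma presented_group_hom_eqI:
  assumes "group G"
    and \<rho>: "\<rho> \<in> hom (presented_group Rel) G" "\<rho> \<in> extensional (carrier (presented_group Rel))"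
    and \<rho>': "\<rho>' \<in> hom (presented_group Rel) G" "\<rho>' \<in> extensional (carrier (presented_group Rel))"
    and eq: "\<And>g. \<rho> (word_class Rel [(g, True)]) = \<rho>' (word_class Rel [(g, True)])"
  shows "\<rho> = \<rho>'"
proof (rule extensionalityI[OF \<rho>(2) \<rho>'(2)])
  interpret \<rho>: group_hom "presented_group Rel" G \<rho>
    using assms group_presented_group by (auto simp: group_hom_def group_hom_axioms_def)
  interpret \<rho>': group_hom "presented_group Rel" G \<rho>'
    using assms group_presented_group by (auto simp: group_hom_def group_hom_axioms_def)
  have carr: "word_class Rel u \<in> carrier (presented_group Rel)" for u
    by (simp add: presented_group_def)
  fix U assume "U \<in> carrier (presented_group Rel)"
  then show "\<rho> U = \<rho>' U"
    by (induction rule: presented_group_induct) (simp_all add: carr eq)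
qed

section \<open>Matrices\<close>

lemma SL_simps [simp]:
  "A \<in> carrier SL \<longleftrightarrow> det A = 1" "A \<otimes>\<^bsub>SL\<^esub> B = A ** B" "\<one>\<^bsub>SL\<^esub> = mat 1"
  by (simp_all add: SL_def)

lemma inv_SL:
  fixes A :: "complex ^ 'n ^ 'n"
  assumes "det A = 1"
  shows "det (inv\<^bsub>SL\<^esub> A) = 1" "inv\<^bsub>SL\<^esub> A ** A = mat 1" "A ** inv\<^bsub>SL\<^esub> A = mat 1"
proof -
  interpret group "SL :: (complex ^ 'n ^ 'n) monoid" by (rule group_SL)
  have A: "A \<in> carrier SL" using assms by simp
  show "det (inv\<^bsub>SL\<^esub> A) = 1" "inv\<^bsub>SL\<^esub> A ** A = mat 1" "A ** inv\<^bsub>SL\<^esub> A = mat 1"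
    using inv_closed[OF A] l_inv[OF A] r_inv[OF A] by simp_all
qed

lemma mat_mult_vec: "mat c *v v = (c :: 'a::comm_semiring_1) *s v"
  by (simp add: vec_eq_iff matrix_vector_mult_def mat_def if_distrib[of "\<lambda>x. x * _"] sum.delta
      cong: if_cong)

text \<open>A dimension count: the injective \<open>A\<close> maps \<open>W\<close> into itself,
  hence onto itself. This lets invariance under a group be tested on generators.\<close>

lemma invariant_subspace_inverse:
  fixes A A' :: "complex ^ 'n ^ 'n"
  assumes "A' ** A = mat 1" and W: "vec.subspace W" "\<And>w. w \<in> W \<Longrightarrow> A *v w \<in> W" and "w \<in> W"
  shows "A' *v w \<in> W"
proof -
  have inv: "A' *v (A *v v) = v" for v
    by (simp add: assms(1) matrix_vector_mul_assoc)
  have lin: "Vector_Spaces.linear (*s) (*s) ((*v) A)" by (rule matrix_vector_mul_linear_gen)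
  have "inj ((*v) A)" by (metis injI inv)
  then have "vec.dim ((*v) A ` W) = vec.dim W"
    by (intro vec.dim_image_eq[OF lin]) (auto intro: inj_on_subset)
  moreover have "(*v) A ` W \<subseteq> W" using W by blast
  ultimately have "(*v) A ` W = W"
    using vec.subspace_dim_equal[OF vec.linear_subspace_image[OF lin W(1)] W(1)] by simp
  then obtain v where "v \<in> W" "w = A *v v" using \<open>w \<in> W\<close> by blast
  then show ?thesis by (simp add: inv)
qed

text \<open>Irreducibility phrased for the generators alone; \<open>irreducible_rep_trefoil\<close>
  matches it with irreducibility of representations.\<close>

definition irreducible_pair :: "complex ^ 'n ^ 'n \<Rightarrow> complex ^ 'n ^ 'n \<Rightarrow> bool" where
  "irreducible_pair A B \<longleftrightarrow>
     (\<forall>W. vec.subspace W \<and> (\<forall>w\<in>W. A *v w \<in> W \<and> B *v w \<in> W) \<longrightarrow> W = {0} \<or> W = UNIV)"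

lemma irreducible_pairD:
  assumes "irreducible_pair A B" "vec.subspace W"
    "\<And>w. w \<in> W \<Longrightarrow> A *v w \<in> W" "\<And>w. w \<in> W \<Longrightarrow> B *v w \<in> W"
  shows "W = {0} \<or> W = UNIV"
  using assms unfolding irreducible_pair_def by blast

text \<open>\<open>Q\<close> carries subspaces invariant under \<open>A'\<close> and
  \<open>B'\<close> to subspaces invariant under \<open>A\<close> and \<open>B\<close>.\<close>

lemma irreducible_pair_similar:
  fixes A B A' B' Q :: "complex ^ 'n ^ 'n"
  assumes irr: "irreducible_pair A B" and Q: "det Q \<noteq> 0"
    and A: "A ** Q = Q ** A'" and B: "B ** Q = Q ** B'"
  shows "irreducible_pair A' B'"
  unfolding irreducible_pair_def
proof (intro allI impI, elim conjE)
  fix W assume W: "vec.subspace W" "\<forall>w\<in>W. A' *v w \<in> W \<and> B' *v w \<in> W"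
  obtain Q' where Q': "Q' ** Q = mat 1"
    using Q by (metis invertible_det_nz invertible_left_inverse)
  then have inv: "Q' *v (Q *v v) = v" for v
    by (simp add: matrix_vector_mul_assoc)
  have AQ: "A *v (Q *v w) = Q *v (A' *v w)" "B *v (Q *v w) = Q *v (B' *v w)" for w
    by (simp_all add: matrix_vector_mul_assoc A B)
  have "(*v) Q ` W = {0} \<or> (*v) Q ` W = UNIV"
  proof (rule irreducible_pairD[OF irr])
    show "vec.subspace ((*v) Q ` W)"
      by (rule vec.linear_subspace_image[OF matrix_vector_mul_linear_gen W(1)])
  qed (use W(2) AQ in force)+
  then show "W = {0} \<or> W = UNIV"
  proof
    assume "(*v) Q ` W = {0}"
    moreover have "W = (*v) Q' ` ((*v) Q ` W)" by (simp add: image_image inv)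
    ultimately show ?thesis by simp
  next
    assume "(*v) Q ` W = UNIV"
    then have "w \<in> W" for w using inv by (metis UNIV_I imageE)
    then show ?thesis by blast
  qed
qed

lemma complex_eigenvector_3:
  fixes M :: "complex ^ 3 ^ 3"
  obtains \<mu> v where "v \<noteq> 0" "M *v v = \<mu> *s v"
proof -
  \<comment> \<open>The sum of the principal minors of order two, so that \<open>p\<close> below is
    the characteristic polynomial \<open>det (M - X)\<close>.\<close>
  define e where "e = M$1$1 * M$2$2 - M$1$2 * M$2$1 + M$1$1 * M$3$3 - M$1$3 * M$3$1
    + M$2$2 * M$3$3 - M$2$3 * M$3$2"
  define p where "p = [:det M, - e, M$1$1 + M$2$2 + M$3$3, - 1:]"
  have "\<not> constant (poly p)" by (simp add: constant_degree p_def)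
  then obtain \<mu> where \<mu>: "poly p \<mu> = 0" using fundamental_theorem_of_algebra by blast
  have "det (M - mat \<mu>) = poly p \<mu>"
    unfolding p_def e_def det_3 by (simp add: mat_def algebra_simps)
  then have "\<not> invertible (M - mat \<mu>)" using \<mu> by (simp add: invertible_det_nz)
  then obtain v where v: "v \<noteq> 0" "(M - mat \<mu>) *v v = 0"
    by (metis invertible_left_inverse matrix_left_invertible_ker)
  then have "M *v v = \<mu> *s v" using v by (simp add: matrix_vector_mult_diff_rdistrib mat_mult_vec)
  then show thesis using v that by blast
qed

lemma vec_span_invariant:
  fixes A :: "complex ^ 'n ^ 'n"
  assumes "\<And>x. x \<in> S \<Longrightarrow> A *v x \<in> vec.span S" "w \<in> vec.span S"
  shows "A *v w \<in> vec.span S"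
  using assms(2)
proof (rule vec.span_induct)
  show "vec.subspace {w. A *v w \<in> vec.span S}"
    by (auto simp: vec.subspace_def matrix_vector_right_distrib vector_scalar_commute
        intro: vec.span_add vec.span_scale vec.span_zero)
qed (use assms(1) in blast)

section \<open>Irreducible pairs of matrices\<close>

text \<open>An eigenspace of \<open>Z\<close> is nonzero and invariant under all matrices commuting
  with \<open>Z\<close>, so irreducibility makes it the whole space.\<close>

lemma irreducible_pair_schur:
  fixes A B Z :: "complex ^ 3 ^ 3"
  assumes irr: "irreducible_pair A B" and Z: "Z ** A = A ** Z" "Z ** B = B ** Z"
  obtains c where "Z = mat c"
proof -
  obtain c v where v: "v \<noteq> 0" "Z *v v = c *s v" using complex_eigenvector_3 .
  let ?W = "{v. Z *v v = c *s v}"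
  have comm: "Z *v (A *v w) = A *v (Z *v w)" "Z *v (B *v w) = B *v (Z *v w)" for w
    by (simp_all add: matrix_vector_mul_assoc Z)
  have "?W = {0} \<or> ?W = UNIV"
  proof (rule irreducible_pairD[OF irr])
    show "vec.subspace ?W"
      by (auto simp: vec.subspace_def matrix_vector_right_distrib vector_scalar_commute
          vec.scale_right_distrib mult.commute)
  qed (auto simp: comm vector_scalar_commute)
  then have "?W = UNIV" using v by blast
  then have "Z = mat c" unfolding matrix_eq by (auto simp: mat_mult_vec)
  then show thesis by (rule that)
qed

text \<open>If \<open>B\<close> also satisfied a quadratic equation, then an eigenvector \<open>w\<close> of \<open>A ** B\<close> would
  span together with \<open>A *v w\<close> an invariant subspace of dimension at most two.\<close>

lemma irreducible_pair_not_quadratic: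
  fixes A B :: "complex ^ 3 ^ 3"
  assumes irr: "irreducible_pair A B" and A: "A ** A = mat c" and "det A \<noteq> 0" "det B \<noteq> 0"
  shows "\<exists>v. B *v (B *v v) - t *s (B *v v) + d *s v \<noteq> 0"
proof (rule ccontr)
  assume "\<not> ?thesis"
  then have B0: "B *v (B *v v) - t *s (B *v v) + d *s v = 0" for v by blast
  have B: "B *v (B *v v) = t *s (B *v v) - d *s v" for v
  proof -
    have "B *v (B *v v) =
        (B *v (B *v v) - t *s (B *v v) + d *s v) + (t *s (B *v v) - d *s v)" by simp
    then show ?thesis unfolding B0 by simp
  qed
  have AA: "A *v (A *v v) = c *s v" for v
    by (simp add: matrix_vector_mul_assoc A mat_mult_vec)
  have inj: "M *v v \<noteq> 0" if "det M \<noteq> 0" "v \<noteq> 0" for M :: "complex ^ 3 ^ 3" and v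
    using that by (metis invertible_det_nz invertible_left_inverse matrix_left_invertible_ker)
  obtain m w where w: "w \<noteq> 0" "(A ** B) *v w = m *s w" using complex_eigenvector_3 .
  then have ABw: "A *v (B *v w) = m *s w" by (simp add: matrix_vector_mul_assoc)
  have "m \<noteq> 0" using inj[of A "B *v w"] inj[of B w] ABw w(1) assms(3,4) by auto
  have "c \<noteq> 0" using inj[of A "A *v w"] inj[of A w] AA[of w] w(1) assms(3) by auto
  \<comment> \<open>Applying \<open>A\<close> to \<open>A B w = m w\<close> and using
    \<open>A^2 = c\<close> puts \<open>B w\<close> on the line of \<open>A w\<close>.\<close>
  have "c *s (B *v w) = m *s (A *v w)"
    using AA[of "B *v w"] by (simp add: ABw vector_scalar_commute)
  then have Bw: "B *v w = (m / c) *s (A *v w)"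
    using \<open>c \<noteq> 0\<close> by (metis divide_inverse mult.commute vec.scale_left_imp_eq vec.scale_scale
        left_inverse vec.scale_one)
  \<comment> \<open>Read backwards, this turns \<open>B (A w)\<close> into a multiple of
    \<open>B (B w)\<close>, where the quadratic relation applies.\<close>
  have "A *v w = (c / m) *s (B *v w)" unfolding Bw using \<open>c \<noteq> 0\<close> \<open>m \<noteq> 0\<close> by simp
  then have BAw: "B *v (A *v w) = (c / m) *s (t *s (B *v w) - d *s w)"
    by (simp add: vector_scalar_commute B)
  let ?S = "{w, A *v w}"
  have base: "w \<in> vec.span ?S" "A *v w \<in> vec.span ?S" by (auto intro: vec.span_base)
  have Bw': "B *v w \<in> vec.span ?S" unfolding Bw by (intro vec.span_scale base)
  have "vec.span ?S = {0} \<or> vec.span ?S = UNIV"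
  proof (rule irreducible_pairD[OF irr])
    show "A *v v \<in> vec.span ?S" if "v \<in> vec.span ?S" for v
      by (rule vec_span_invariant[OF _ that]) (auto simp: AA intro: base(2) vec.span_scale[OF base(1)])
    have "B *v (A *v w) \<in> vec.span ?S"
      unfolding BAw by (intro vec.span_scale vec.span_diff base Bw')
    then show "B *v v \<in> vec.span ?S" if "v \<in> vec.span ?S" for v
      by (intro vec_span_invariant[OF _ that]) (auto intro: Bw')
  qed (rule vec.subspace_span)
  then have "vec.span ?S = UNIV" using base(1) w(1) by blast
  then have "vec.dim (UNIV :: (complex ^ 3) set) \<le> card ?S"
    by (intro vec.dim_le_card) auto
  also have "card ?S \<le> 2" by (simp add: card_insert_if)
  finally show False unfolding vec_dim_card by simp
qed

text \<open>Factor \<open>X^3 - b^3 = (X - b) (X^2 + b X + b^2)\<close>. By \<open>nq\<close> the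
  quadratic factor does not annihilate everything, and its values lie in the eigenspace of
  \<open>b\<close>.\<close>

lemma cube_scalar_eigenvector:
  fixes B :: "complex ^ 'n ^ 'n"
  assumes cube: "B ** B ** B = mat (b ^ 3)"
    and nq: "\<And>t d. \<exists>v. B *v (B *v v) - t *s (B *v v) + d *s v \<noteq> 0"
  obtains e where "e \<noteq> 0" "B *v e = b *s e"
proof -
  obtain u where u: "B *v (B *v u) - (- b) *s (B *v u) + (b\<^sup>2) *s u \<noteq> 0" using nq by blast
  have "B *v (B *v (B *v u)) = (b ^ 3) *s u"
    by (simp add: matrix_vector_mul_assoc matrix_mul_assoc cube mat_mult_vec)
  then have "B *v (B *v (B *v u) - (- b) *s (B *v u) + (b\<^sup>2) *s u) =
      b *s (B *v (B *v u) - (- b) *s (B *v u) + (b\<^sup>2) *s u)"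
    by (simp add: matrix_vector_right_distrib matrix_vector_mult_diff_distrib vector_scalar_commute
        vec.scale_right_distrib vec.scale_right_diff_distrib power2_eq_square power3_eq_cube
        algebra_simps)
  with u show thesis by (rule that)
qed

section \<open>Cube roots of unity and the normal form of irreducible pairs\<close>

definition cbrt1 :: complex where
  "cbrt1 = Complex (- 1 / 2) (sqrt 3 / 2)"

lemma cbrt1_power2: "cbrt1\<^sup>2 = - 1 - cbrt1"
  by (simp add: cbrt1_def complex_eq_iff power2_eq_square)

lemma cbrt1_cube: "cbrt1 ^ 3 = 1"
proof -
  have "cbrt1 ^ 3 = cbrt1 * cbrt1\<^sup>2" by (simp add: power3_eq_cube power2_eq_square)
  also have "\<dots> = cbrt1 * (- 1 - cbrt1)" by (simp only: cbrt1_power2)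
  also have "\<dots> = - cbrt1 - cbrt1\<^sup>2" by (simp add: algebra_simps power2_eq_square)
  also have "\<dots> = 1" unfolding cbrt1_power2 by simp
  finally show ?thesis .
qed

text \<open>This is the discrete Fourier transform of order three: adding the equations isolates
  \<open>a\<close>, because the three cube roots of unity sum to zero. It yields the independence of
  the eigenvectors of \<open>B\<close>.\<close>

lemma cbrt1_system:
  assumes 1: "a + b + c = 0" and 2: "a + cbrt1 * b + cbrt1\<^sup>2 * c = 0"
    and 3: "a + cbrt1\<^sup>2 * b + cbrt1 * c = 0"
  shows "a = 0 \<and> b = 0 \<and> c = 0"
proof -
  have "3 * a = (a + b + c) + (a + cbrt1 * b + cbrt1\<^sup>2 * c) + (a + cbrt1\<^sup>2 * b + cbrt1 * c)"
    unfolding cbrt1_power2 by (simp add: algebra_simps)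
  then have a: "a = 0" unfolding 1 2 3 by simp
  with 1 have c: "c = - b" by (simp add: eq_neg_iff_add_eq_0 add.commute)
  have "1 + 2 * cbrt1 \<noteq> 0" by (simp add: cbrt1_def complex_eq_iff)
  moreover have "(1 + 2 * cbrt1) * b = 0"
    using 2 unfolding a c cbrt1_power2 by (simp add: algebra_simps)
  ultimately show ?thesis using a c by simp
qed

definition diag3 :: "complex ^ 3 ^ 3" where
  "diag3 = (\<chi> i j. if i = j then vector [1, cbrt1, cbrt1\<^sup>2] $ i else 0)"

text \<open>Barycentric coordinates on the plane: they sum to 1, and their zero loci are the three
  lines.\<close>

definition weights :: "complex ^ 2 \<Rightarrow> complex ^ 3" where
  "weights z = vector [z $ 1, z $ 2, 1 - z $ 1 - z $ 2]"

text \<open>This is \<open>2 P - 1\<close>, where every column of \<open>P\<close> is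
  \<open>weights z\<close>. As the weights sum to 1, \<open>P\<close> is a projection of rank one,
  so the square is 1.\<close>

definition reflection3 :: "complex ^ 2 \<Rightarrow> complex ^ 3 ^ 3" where
  "reflection3 z = (\<chi> i j. 2 * weights z $ i - (if i = j then 1 else 0))"

lemma eq3_simps [simp]: "(1::3) \<noteq> 2" "(2::3) \<noteq> 1" "(1::3) \<noteq> 3" "(3::3) \<noteq> 1" "(2::3) \<noteq> 3" "(3::3) \<noteq> 2"
  by simp_all

lemma det_diag3: "det diag3 = 1"
  using cbrt1_cube by (simp add: det_3 diag3_def power2_eq_square power3_eq_cube mult.assoc)

lemma diag3_cube: "diag3 ** diag3 ** diag3 = mat 1"
  using cbrt1_cube
  by (simp add: vec_eq_iff forall_3 matrix_matrix_mult_def sum_3 diag3_def mat_def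
      power2_eq_square power3_eq_cube algebra_simps)

lemma det_reflection3: "det (reflection3 z) = 1"
  by (simp add: det_3 reflection3_def weights_def algebra_simps)

lemma reflection3_square: "reflection3 z ** reflection3 z = mat 1"
  by (simp add: vec_eq_iff forall_3 matrix_matrix_mult_def sum_3 reflection3_def weights_def
      mat_def algebra_simps)

text \<open>All three cube roots of \<open>b^3\<close> are eigenvalues by
  \<open>cube_scalar_eigenvector\<close>. Eigenvectors for distinct eigenvalues are independent, so
  they form the columns of an invertible \<open>Q\<close>.\<close>

lemma cube_scalar_diagonalization:
  fixes B :: "complex ^ 3 ^ 3"
  assumes cube: "B ** B ** B = mat (b ^ 3)" and "b \<noteq> 0"
    and nq: "\<And>t d. \<exists>v. B *v (B *v v) - t *s (B *v v) + d *s v \<noteq> 0"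
  obtains Q where "det Q \<noteq> 0" "B ** Q = Q ** (\<chi> i j. b * diag3 $ i $ j)"
proof -
  have "\<exists>e. e \<noteq> 0 \<and> B *v e = (b * vector [1, cbrt1, cbrt1\<^sup>2] $ i) *s e" for i :: 3
  proof -
    have "cbrt1 ^ 6 = 1" using power_mult[of cbrt1 3 2] cbrt1_cube by simp
    then have "(b * vector [1, cbrt1, cbrt1\<^sup>2] $ i) ^ 3 = b ^ 3"
      using exhaust_3[of i] cbrt1_cube by (auto simp: power_mult_distrib power_mult[symmetric])
    then show ?thesis using cube_scalar_eigenvector[OF _ nq] cube by metis
  qed
  then obtain e where e: "\<And>i::3. e i \<noteq> 0"
      "\<And>i. B *v e i = (b * vector [1, cbrt1, cbrt1\<^sup>2] $ i) *s e i"
    by metis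
  define Q :: "complex ^ 3 ^ 3" where "Q = (\<chi> i j. e j $ i)"
  have Qv: "Q *v x = x $ 1 *s e 1 + x $ 2 *s e 2 + x $ 3 *s e 3" for x
    by (simp add: vec_eq_iff matrix_vector_mult_def Q_def sum_3 mult.commute)
  define D :: "complex ^ 3 ^ 3" where "D = (\<chi> i j. b * diag3 $ i $ j)"
  have BQ: "B ** Q = Q ** D"
    unfolding matrix_eq
  proof
    fix x
    have "(B ** Q) *v x = B *v (Q *v x)" by (simp add: matrix_vector_mul_assoc)
    also have "\<dots> = Q *v (D *v x)"
      unfolding Qv matrix_vector_right_distrib vector_scalar_commute e(2)
      by (simp add: D_def diag3_def matrix_vector_mult_def sum_3 ac_simps)
    finally show "(B ** Q) *v x = (Q ** D) *v x" by (simp add: matrix_vector_mul_assoc)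
  qed
  \<comment> \<open>A linear relation among the eigenvectors remains one after applying
    \<open>D\<close> to its coefficients. Up to the factor \<open>b\<close>, the relation and its
    first two images form the system of \<open>cbrt1_system\<close>.\<close>
  have "x = 0" if x: "Q *v x = 0" for x
  proof -
    have step: "Q *v (D *v y) = 0" if "Q *v y = 0" for y
      using that BQ by (metis matrix_vector_mul_assoc matrix_vector_mult_0_right)
    have "D *v y = b *s vector [y $ 1, cbrt1 * y $ 2, cbrt1\<^sup>2 * y $ 3]" for y
      by (simp add: vec_eq_iff forall_3 D_def diag3_def matrix_vector_mult_def sum_3)
    then have step: "Q *v vector [y $ 1, cbrt1 * y $ 2, cbrt1\<^sup>2 * y $ 3] = 0" if "Q *v y = 0" for y
      using step[OF that] \<open>b \<noteq> 0\<close> by (simp add: vector_scalar_commute)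
    define x1 x2 x3 where "x1 = x $ 1 *s e 1" and "x2 = x $ 2 *s e 2" and "x3 = x $ 3 *s e 3"
    have 0: "x1 + x2 + x3 = 0" using x by (simp add: Qv x1_def x2_def x3_def)
    have 1: "x1 + cbrt1 *s x2 + cbrt1\<^sup>2 *s x3 = 0"
      using step[OF x] by (simp add: Qv x1_def x2_def x3_def)
    have "x1 + (cbrt1 * cbrt1) *s x2 + (cbrt1\<^sup>2 * cbrt1\<^sup>2) *s x3 = 0"
      using step[OF step[OF x]] by (simp add: Qv x1_def x2_def x3_def mult.assoc)
    then have 2: "x1 + (cbrt1 * cbrt1) *s x2 + cbrt1 *s x3 = 0"
      using cbrt1_cube by (simp add: power2_eq_square power3_eq_cube mult.assoc)
    have "x1 $ i = 0 \<and> x2 $ i = 0 \<and> x3 $ i = 0" for i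
      using arg_cong[OF 0, of "\<lambda>v. v $ i"] arg_cong[OF 1, of "\<lambda>v. v $ i"]
        arg_cong[OF 2, of "\<lambda>v. v $ i"]
      by (intro cbrt1_system) (simp_all add: power2_eq_square)
    then have "x1 = 0 \<and> x2 = 0 \<and> x3 = 0" by (simp add: vec_eq_iff)
    then show "x = 0" using e(1) by (auto simp: x1_def x2_def x3_def vec_eq_iff forall_3)
  qed
  then have "det Q \<noteq> 0"
    by (metis invertible_det_nz invertible_left_inverse matrix_left_invertible_ker)
  with BQ show thesis unfolding D_def by (intro that)
qed

lemma det_scale3: "det (\<chi> i j. c * (M :: 'a::comm_ring_1 ^ 3 ^ 3) $ i $ j) = c ^ 3 * det M"
  by (simp add: det_3 algebra_simps power3_eq_cube)

lemma matrix_mult_scale: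
  "A ** (\<chi> i j. c * M $ i $ j) = (\<chi> i j. (c :: 'a::comm_semiring_1) * (A ** M) $ i $ j)"
  by (simp add: vec_eq_iff matrix_matrix_mult_def sum_distrib_left ac_simps)

lemma matrix_scale_mult:
  "(\<chi> i j. c * A $ i $ j) ** M = (\<chi> i j. (c :: 'a::comm_semiring_1) * (A ** M) $ i $ j)"
  by (simp add: vec_eq_iff matrix_matrix_mult_def sum_distrib_left ac_simps)

text \<open>An involution of determinant 1 is its own adjugate, so the off-diagonal minors of order two
  of \<open>M = A + 1\<close> vanish and the three principal ones all equal \<open>trace A + 1\<close>.\<close>

lemma involution_minors:
  fixes A :: "complex ^ 3 ^ 3"
  assumes A: "A ** A = mat 1" and "det A = 1"
  defines "M \<equiv> \<chi> i j. A $ i $ j + (if i = j then 1 else 0)"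
  shows "(A$1$1 + A$2$2 + A$3$3 + 1) * A$2$1 = 0" (is "?\<tau> * _ = 0")
    and "(A$1$1 + A$2$2 + A$3$3 + 1) * A$3$1 = 0"
    and "A$1$1 + A$2$2 + A$3$3 + 1 = 0 \<Longrightarrow> M $ i $ j * M $ k $ l = M $ i $ l * M $ k $ j"
proof -
  \<comment> \<open>The transposed cofactor matrix; \<open>C ** A\<close> and \<open>A ** A\<close>
    are both the identity, whence \<open>C = A\<close>.\<close>
  define C :: "complex ^ 3 ^ 3" where "C = vector
    [vector [A$2$2 * A$3$3 - A$2$3 * A$3$2, A$1$3 * A$3$2 - A$1$2 * A$3$3, A$1$2 * A$2$3 - A$1$3 * A$2$2],
     vector [A$2$3 * A$3$1 - A$2$1 * A$3$3, A$1$1 * A$3$3 - A$1$3 * A$3$1, A$1$3 * A$2$1 - A$1$1 * A$2$3],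
     vector [A$2$1 * A$3$2 - A$2$2 * A$3$1, A$1$2 * A$3$1 - A$1$1 * A$3$2, A$1$1 * A$2$2 - A$1$2 * A$2$1]]"
  have "C ** A = mat (det A)"
    unfolding C_def det_3
    by (simp add: vec_eq_iff forall_3 matrix_matrix_mult_def sum_3 mat_def algebra_simps)
  then have "C = A" using A assms(2) by (metis matrix_mul_assoc matrix_mul_lid matrix_mul_rid)
  then have "C $ i $ j = A $ i $ j" for i j by simp
  from this[of 1 1] this[of 1 2] this[of 1 3] this[of 2 1] this[of 2 2] this[of 2 3]
    this[of 3 1] this[of 3 2] this[of 3 3]
  have adj: "A$2$2 * A$3$3 - A$2$3 * A$3$2 = A$1$1" "A$1$3 * A$3$2 - A$1$2 * A$3$3 = A$1$2"
    "A$1$2 * A$2$3 - A$1$3 * A$2$2 = A$1$3" "A$2$3 * A$3$1 - A$2$1 * A$3$3 = A$2$1"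
    "A$1$1 * A$3$3 - A$1$3 * A$3$1 = A$2$2" "A$1$3 * A$2$1 - A$1$1 * A$2$3 = A$2$3"
    "A$2$1 * A$3$2 - A$2$2 * A$3$1 = A$3$1" "A$1$2 * A$3$1 - A$1$1 * A$3$2 = A$3$2"
    "A$1$1 * A$2$2 - A$1$2 * A$2$1 = A$3$3"
    by (simp_all add: C_def)
  \<comment> \<open>A combination of differences that all vanish by the identities
    \<open>adj\<close>.\<close>
  have "?\<tau> * A$2$1 = A$2$1 * (A$1$1 - (A$2$2 * A$3$3 - A$2$3 * A$3$2))
      + (A$2$2 + 1) * (A$2$1 - (A$2$3 * A$3$1 - A$2$1 * A$3$3))
      + A$2$3 * (A$3$1 - (A$2$1 * A$3$2 - A$2$2 * A$3$1))"
    by (simp add: algebra_simps)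
  then show "?\<tau> * A$2$1 = 0" by (simp only: adj diff_self mult_zero_right add_0)
  have "?\<tau> * A$3$1 = A$3$1 * (A$1$1 - (A$2$2 * A$3$3 - A$2$3 * A$3$2))
      + A$3$2 * (A$2$1 - (A$2$3 * A$3$1 - A$2$1 * A$3$3))
      + (A$3$3 + 1) * (A$3$1 - (A$2$1 * A$3$2 - A$2$2 * A$3$1))"
    by (simp add: algebra_simps)
  then show "?\<tau> * A$3$1 = 0" by (simp only: adj diff_self mult_zero_right add_0)
  assume "?\<tau> = 0"
  then have "(A$1$1 + 1) * (A$2$2 + 1) = A$1$2 * A$2$1" "(A$1$1 + 1) * (A$3$3 + 1) = A$1$3 * A$3$1"
    "(A$2$2 + 1) * (A$3$3 + 1) = A$2$3 * A$3$2"
    using adj(1,5,9) by algebra+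
  moreover have "A$1$2 * A$2$3 = A$1$3 * (A$2$2 + 1)" "A$1$3 * A$3$2 = A$1$2 * (A$3$3 + 1)"
    "A$2$3 * A$3$1 = A$2$1 * (A$3$3 + 1)" "A$1$3 * A$2$1 = (A$1$1 + 1) * A$2$3"
    "A$2$1 * A$3$2 = (A$2$2 + 1) * A$3$1" "A$1$2 * A$3$1 = (A$1$1 + 1) * A$3$2"
    using adj(2,3,4,6,7,8) by (simp_all add: algebra_simps)
  ultimately have "\<forall>i j k l. M $ i $ j * M $ k $ l = M $ i $ l * M $ k $ j"
    unfolding forall_3 M_def by (simp add: algebra_simps)
  then show "M $ i $ j * M $ k $ l = M $ i $ l * M $ k $ j" by blast
qed

text \<open>Coordinate axes and coordinate planes are invariant under \<open>diag3\<close>, so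
  irreducibility forbids \<open>A\<close> to preserve them. Together with the vanishing minors this
  makes the needed entries of \<open>M = A + 1\<close> nonzero, and a diagonal change of basis,
  which commutes with \<open>diag3\<close>, finishes.\<close>

lemma irreducible_pair_diag3:
  fixes A :: "complex ^ 3 ^ 3"
  assumes irr: "irreducible_pair A diag3" and A: "A ** A = mat 1" "det A = 1"
  obtains z K where "det K \<noteq> 0" "A ** K = K ** reflection3 z" "diag3 ** K = K ** diag3"
    "\<And>i. weights z $ i \<noteq> 0"
proof -
  define M :: "complex ^ 3 ^ 3" where "M = (\<chi> i j. A $ i $ j + (if i = j then 1 else 0))"
  have D: "diag3 *v v = (\<chi> i. diag3 $ i $ i * v $ i)" for v
    by (simp add: vec_eq_iff forall_3 matrix_vector_mult_def sum_3 diag3_def)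
  have AM: "(A *v v) $ i = (\<Sum>j\<in>UNIV. M $ i $ j * v $ j) - v $ i" for v i
  proof -
    have "(\<Sum>j\<in>UNIV. (if i = j then 1 else 0) * v $ j) = v $ i"
      by (simp add: if_distrib[of "\<lambda>x. x * _"] sum.delta cong: if_cong)
    then show ?thesis by (simp add: M_def matrix_vector_mult_def distrib_right sum.distrib)
  qed
  have axis: "\<exists>j. M $ j $ i \<noteq> 0 \<and> j \<noteq> i" for i
  proof (rule ccontr)
    assume "\<not> ?thesis"
    then have M0: "M $ j $ i = 0" if "j \<noteq> i" for j using that by blast
    let ?W = "{v :: complex ^ 3. \<forall>j. j \<noteq> i \<longrightarrow> v $ j = 0}"
    have "?W = {0} \<or> ?W = UNIV"
    proof (rule irreducible_pairD[OF irr])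
      fix v assume v: "v \<in> ?W"
      have "(\<Sum>k\<in>UNIV. M $ j $ k * v $ k) = 0" if "j \<noteq> i" for j
      proof (rule sum.neutral, rule ballI)
        fix k show "M $ j $ k * v $ k = 0"
          using v M0[OF that] by (cases "k = i") auto
      qed
      then show "A *v v \<in> ?W" using v by (auto simp: AM)
    qed (auto simp: vec.subspace_def D)
    moreover obtain j where "j \<noteq> i" using exhaust_3[of i] by (metis eq3_simps(1))
    then have "axis j 1 \<notin> ?W" by (auto simp: axis_def)
    moreover have "axis i 1 \<in> ?W" "axis i (1::complex) \<noteq> 0" by (auto simp: axis_def vec_eq_iff)
    ultimately show False by blast
  qed
  have row: "\<exists>j. M $ i $ j \<noteq> 0" for i
  proof (rule ccontr)
    assume "\<not> ?thesis"
    then have M0: "M $ i $ j = 0" for j by blast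
    let ?W = "{v :: complex ^ 3. v $ i = 0}"
    have "?W = {0} \<or> ?W = UNIV"
      by (rule irreducible_pairD[OF irr]) (auto simp: vec.subspace_def D AM M0)
    moreover obtain j where "j \<noteq> i" using exhaust_3[of i] by (metis eq3_simps(1))
    then have "axis j 1 \<in> ?W" "axis j (1::complex) \<noteq> 0" by (auto simp: axis_def vec_eq_iff)
    moreover have "axis i 1 \<notin> ?W" by (auto simp: axis_def)
    ultimately show False by blast
  qed
  obtain j where "M $ j $ 1 \<noteq> 0" "j \<noteq> 1" using axis by blast
  then have "A $ 2 $ 1 \<noteq> 0 \<or> A $ 3 $ 1 \<noteq> 0" using exhaust_3[of j] by (auto simp: M_def)
  \<comment> \<open>The nonzero off-diagonal entry cancels from one of the products in
    \<open>involution_minors\<close>, leaving trace \<open>-1\<close>.\<close>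
  then have tr: "A$1$1 + A$2$2 + A$3$3 + 1 = 0"
    using involution_minors(1,2)[OF A] by auto
  have minors: "M $ i $ j * M $ k $ l = M $ i $ l * M $ k $ j" for i j k l
    unfolding M_def by (rule involution_minors(3)[OF A tr])
  \<comment> \<open>Column \<open>i\<close> has a nonzero entry off the diagonal and row
    \<open>i\<close> has a nonzero entry; a minor equates their product with a multiple of
    \<open>M $ i $ i\<close>.\<close>
  have diag: "M $ i $ i \<noteq> 0" for i
    using minors[of i _ _ i] row[of i] axis[of i] by (metis mult_eq_0_iff)
  have row1: "M $ 1 $ j \<noteq> 0" for j
    using minors[of 1 j j 1] diag by (metis mult_eq_0_iff)
  define z :: "complex ^ 2" where "z = vector [M $ 1 $ 1 / 2, M $ 2 $ 2 / 2]"
  have "M $ 3 $ 3 = 2 - M $ 1 $ 1 - M $ 2 $ 2"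
    using tr by (simp add: M_def) algebra
  then have weights: "weights z $ i = M $ i $ i / 2" for i
    using exhaust_3[of i] by (auto simp: weights_def z_def vector_2 diff_divide_distrib)
  \<comment> \<open>Conjugating by this scaling multiplies \<open>M $ i $ j\<close> by
    \<open>M $ 1 $ i / M $ 1 $ j\<close>, which by the minors gives \<open>M $ i $ i\<close>,
    independent of \<open>j\<close>.\<close>
  define K :: "complex ^ 3 ^ 3" where "K = (\<chi> i j. if i = j then 1 / M $ 1 $ i else 0)"
  show thesis
  proof
    show "det K \<noteq> 0" using row1 by (simp add: K_def det_3)
    show "weights z $ i \<noteq> 0" for i using diag by (simp add: weights)
    show "diag3 ** K = K ** diag3"
      by (simp add: vec_eq_iff forall_3 matrix_matrix_mult_def sum_3 K_def diag3_def)
    have AK: "A $ i $ j / M $ 1 $ j = reflection3 z $ i $ j / M $ 1 $ i" for i j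
      using minors[of i j 1 i] row1[of i] row1[of j] weights[of i]
      by (auto simp: reflection3_def M_def field_simps split: if_splits)
    have "(A ** K) $ i $ j = A $ i $ j / M $ 1 $ j" for i j
      using exhaust_3[of j] by (auto simp: matrix_matrix_mult_def sum_3 K_def)
    moreover have "(K ** reflection3 z) $ i $ j = reflection3 z $ i $ j / M $ 1 $ i" for i j
      using exhaust_3[of i] by (auto simp: matrix_matrix_mult_def sum_3 K_def)
    ultimately show "A ** K = K ** reflection3 z" by (simp add: vec_eq_iff AK)
  qed
qed

text \<open>\<open>A^2\<close> commutes with \<open>A\<close>, and with \<open>B\<close> since it
  equals \<open>B^3\<close>; hence it is scalar. \<open>B\<close> is then diagonalized, and
  \<open>irreducible_pair_diag3\<close> treats \<open>A\<close> in its eigenbasis.\<close>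

lemma irreducible_pair_normal_form:
  fixes A B :: "complex ^ 3 ^ 3"
  assumes irr: "irreducible_pair A B" and AB: "A ** A = B ** B ** B"
    and det: "det A = 1" "det B = 1"
  obtains z K where "det K = 1" "A ** K = K ** reflection3 z" "B ** K = K ** diag3"
    "\<And>i. weights z $ i \<noteq> 0"
proof -
  obtain c where c: "A ** A = mat c"
    by (rule irreducible_pair_schur[OF irr, of "A ** A"])
      (simp_all add: matrix_mul_assoc, simp add: AB matrix_mul_assoc[symmetric])
  note nq = irreducible_pair_not_quadratic[OF irr c, unfolded det, simplified]
  have "det (mat c :: complex ^ 3 ^ 3) = c ^ 3" by (simp add: det_3 mat_def power3_eq_cube)
  then have c3: "c ^ 3 = 1" using arg_cong[OF c, of det] det by (simp add: det_mul)
  then have "c \<noteq> 0" by auto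
  have diagonalize: "\<exists>Q. det Q \<noteq> 0 \<and> B ** Q = Q ** (\<chi> i j. b * diag3 $ i $ j)" if "b ^ 3 = c" for b
  proof -
    have "B ** B ** B = mat (b ^ 3)" "b \<noteq> 0" using AB c \<open>c \<noteq> 0\<close> that by auto
    from cube_scalar_diagonalization[OF this nq] show ?thesis by metis
  qed
  \<comment> \<open>A first diagonalization with an arbitrary cube root of \<open>c\<close> serves
    only to compare determinants, giving \<open>c = 1\<close>; the second one then uses
    \<open>b = 1\<close>.\<close>
  obtain b where b: "b ^ 3 = c" by (metis exists_complex_root zero_neq_numeral)
  then obtain R where R: "det R \<noteq> 0" "B ** R = R ** (\<chi> i j. b * diag3 $ i $ j)"
    using diagonalize by blast
  from arg_cong[OF R(2), of det] have "det R = det R * c"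
    by (simp only: det_mul det_scale3 det_diag3 det b mult_1 mult_1_right)
  with R(1) have "c = 1" by simp
  then obtain Q where Q: "det Q \<noteq> 0" "B ** Q = Q ** diag3"
    using diagonalize[of 1] by auto
  obtain Q' where Q': "Q' ** Q = mat 1" "Q ** Q' = mat 1"
    using Q(1) by (metis invertible_det_nz invertible_def)
  define A' where "A' = Q' ** A ** Q"
  have AQ: "A ** Q = Q ** A'"
    by (simp add: A'_def matrix_mul_assoc Q')
  have "irreducible_pair A' diag3"
    by (rule irreducible_pair_similar[OF irr Q(1) AQ Q(2)])
  moreover have "A' ** A' = mat 1"
  proof -
    have "A' ** A' = Q' ** (A ** (Q ** Q') ** A) ** Q" by (simp add: A'_def matrix_mul_assoc)
    then show ?thesis using c \<open>c = 1\<close> by (simp add: Q')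
  qed
  moreover have "det A' = 1"
    using arg_cong[OF AQ, of det] Q(1) det by (simp add: det_mul)
  ultimately obtain z K where K: "det K \<noteq> 0" "A' ** K = K ** reflection3 z" "diag3 ** K = K ** diag3"
    "\<And>i. weights z $ i \<noteq> 0"
    using irreducible_pair_diag3 by blast
  define P where "P = Q ** K"
  have mult: "X ** P = P ** Z" if "X ** Q = Q ** Y" "Y ** K = K ** Z" for X Y Z
  proof -
    have "X ** P = Q ** (Y ** K)" by (simp add: P_def matrix_mul_assoc that(1))
    then show ?thesis by (simp add: P_def matrix_mul_assoc that(2))
  qed
  have P: "det P \<noteq> 0" "A ** P = P ** reflection3 z" "B ** P = P ** diag3"
  proof -
    show "det P \<noteq> 0" using K(1) Q(1) by (simp add: P_def det_mul)
  qed (rule mult[OF AQ K(2)], rule mult[OF Q(2) K(3)])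
  \<comment> \<open>Rescaling by this root gives the intertwiner determinant 1, so that the
    conjugation takes place inside the special linear group.\<close>
  obtain k where k: "k ^ 3 = 1 / det P" by (metis exists_complex_root zero_neq_numeral)
  show thesis
  proof
    show "det (\<chi> i j. k * P $ i $ j) = 1" using k P(1) by (simp add: det_scale3)
    show "A ** (\<chi> i j. k * P $ i $ j) = (\<chi> i j. k * P $ i $ j) ** reflection3 z"
      by (simp add: matrix_mult_scale matrix_scale_mult P)
    show "B ** (\<chi> i j. k * P $ i $ j) = (\<chi> i j. k * P $ i $ j) ** diag3"
      by (simp add: matrix_mult_scale matrix_scale_mult P)
  qed (rule K(4))
qed

section \<open>The commutator determinant\<close>

definition commutator_det :: "complex ^ 3 ^ 3 \<Rightarrow> complex ^ 3 ^ 3 \<Rightarrow> complex" where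
  "commutator_det A B = (let C = A ** B ** A - A ** B in det (B ** C - C ** B))"

text \<open>A commutator with a diagonal matrix has zero diagonal, so only the two 3-cycles
  contribute to the determinant. Each row \<open>i\<close> carries a factor
  \<open>2 * s $ i\<close>, and what remains is the constant 54, whatever the value of
  \<open>t\<close>.\<close>

lemma commutator_det_reflection3:
  "commutator_det (reflection3 z) diag3 = 432 * (weights z $ 1 * weights z $ 2 * weights z $ 3)"
proof -
  define s where "s = weights z"
  define w where "w = cbrt1"
  have w: "w * w = - 1 - w" unfolding w_def using cbrt1_power2 by (simp add: power2_eq_square)
  have s3: "s $ 3 = 1 - s $ 1 - s $ 2" by (simp add: s_def weights_def)
  define t where "t = 2 * (s $ 1 + w * s $ 2 + w * w * s $ 3)"
  define C where "C = reflection3 z ** diag3 ** reflection3 z - reflection3 z ** diag3"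
  define E where "E = diag3 ** C - C ** diag3"
  have C: "C $ i $ j = 2 * s $ i * (t - d i - 2 * d j)"
    if "i \<noteq> j" "d = (\<lambda>i. vector [1, w, w * w] $ i)" for i j d
    unfolding C_def t_def reflection3_def s_def[symmetric] diag3_def w_def[symmetric]
    using that exhaust_3[of i] exhaust_3[of j]
    by (auto simp: matrix_matrix_mult_def sum_3 power2_eq_square algebra_simps)
  have "E $ i $ j = (vector [1, w, w * w] $ i - vector [1, w, w * w] $ j) * C $ i $ j" for i j :: 3
    unfolding E_def diag3_def w_def[symmetric] using exhaust_3[of i] exhaust_3[of j]
    by (auto simp: matrix_matrix_mult_def sum_3 power2_eq_square algebra_simps)
  note E = this[of 1 1] this[of 2 2] this[of 3 3] this[of 1 2] this[of 1 3] this[of 2 1]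
    this[of 2 3] this[of 3 1] this[of 3 2]
  have "det E = 8 * (s $ 1 * s $ 2 * s $ 3) *
     ((1 - w) * (w - w * w) * (w * w - 1) * (t - 1 - 2 * w) * (t - w - 2 * (w * w)) * (t - w * w - 2) +
      (1 - w * w) * (w - 1) * (w * w - w) * (t - 1 - 2 * (w * w)) * (t - w - 2) * (t - w * w - 2 * w))"
    unfolding det_3 E by (simp add: C) algebra
  also have "(1 - w) * (w - w * w) * (w * w - 1) * (t - 1 - 2 * w) * (t - w - 2 * (w * w)) * (t - w * w - 2) +
      (1 - w * w) * (w - 1) * (w * w - w) * (t - 1 - 2 * (w * w)) * (t - w - 2) * (t - w * w - 2 * w)
      = 54"
    using w by algebra
  finally show ?thesis by (simp add: commutator_det_def Let_def E_def C_def s_def)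
qed

lemma commutator_det_similar:
  assumes "det K \<noteq> 0" "A ** K = K ** A'" "B ** K = K ** B'"
  shows "commutator_det A B = commutator_det A' B'"
proof -
  define C C' where "C = A ** B ** A - A ** B" and "C' = A' ** B' ** A' - A' ** B'"
  have diff: "X ** K - Y ** K = (X - Y) ** K" "K ** X - K ** Y = K ** (X - Y)" for X Y
    by (simp_all add: vec_eq_iff matrix_matrix_mult_def sum_subtractf left_diff_distrib
        right_diff_distrib)
  have mult: "X ** Y ** K = K ** (X' ** Y')" if "X ** K = K ** X'" "Y ** K = K ** Y'" for X X' Y Y'
    using that by (metis matrix_mul_assoc)
  have AB: "A ** B ** K = K ** (A' ** B')" by (rule mult[OF assms(2,3)])
  have "C ** K = K ** C'"
    unfolding C_def C'_def diff[symmetric] AB mult[OF AB assms(2)] ..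
  then have "(B ** C - C ** B) ** K = K ** (B' ** C' - C' ** B')"
    unfolding diff[symmetric] by (simp add: mult assms)
  from arg_cong[OF this, of det] show ?thesis
    using assms(1) by (simp add: det_mul commutator_det_def Let_def C_def C'_def)
qed

text \<open>In dimension three, either \<open>W\<close> or the quotient by \<open>W\<close> is a
  line. Scalars commute, so the commutator acts as zero on that line and is singular.\<close>

lemma det_commutator_invariant_subspace:
  fixes X Y :: "complex ^ 3 ^ 3"
  assumes W: "vec.subspace W" "W \<noteq> {0}" "W \<noteq> UNIV"
    and X: "\<And>w. w \<in> W \<Longrightarrow> X *v w \<in> W" and Y: "\<And>w. w \<in> W \<Longrightarrow> Y *v w \<in> W"
  shows "det (X ** Y - Y ** X) = 0"
proof (rule ccontr)
  define E where "E = X ** Y - Y ** X"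
  have E: "E *v v = X *v (Y *v v) - Y *v (X *v v)" for v
    by (simp add: E_def matrix_vector_mult_diff_rdistrib matrix_vector_mul_assoc)
  assume "det (X ** Y - Y ** X) \<noteq> 0"
  then obtain E' where E': "E' ** E = mat 1" "E ** E' = mat 1"
    unfolding E_def by (metis invertible_det_nz invertible_def)
  have "0 \<in> W" using W(1) by (rule vec.subspace_0)
  have span: "vec.span W = W" using W(1) by (simp add: vec.span_eq_iff)
  have dimU: "vec.dim (UNIV :: (complex ^ 3) set) = 3" unfolding vec_dim_card by simp
  have pos: "vec.dim W \<noteq> 0" using W(2) \<open>0 \<in> W\<close> by auto
  have full: "vec.span S = UNIV" if "vec.dim S = 3" for S :: "(complex ^ 3) set"
    using that vec.dim_eq_full[of S] dimU by (simp add: vec.dimension_def)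
  have "vec.dim W \<noteq> 3" using full[of W] W(3) unfolding span by blast
  moreover have "vec.dim W \<le> 3" using vec.dim_subset[of W UNIV] unfolding dimU by simp
  ultimately consider "vec.dim W = 1" | "vec.dim W = 2" using pos by linarith
  then show False
  proof cases
    case 1
    obtain S where S: "S \<subseteq> W" "vec.independent S" "W \<subseteq> vec.span S" "card S = 1"
      using vec.basis_exists[of W] 1 by metis
    then obtain v where v: "S = {v}" by (auto simp: card_1_singleton_iff)
    then have "v \<noteq> 0" using S(2) vec.dependent_zero by blast
    have "v \<in> W" using S v by blast
    then obtain x y where "X *v v = x *s v" "Y *v v = y *s v"
      using X[of v] Y[of v] S(3) unfolding v vec.span_singleton by blast
    then have "E *v v = 0" by (simp add: E vector_scalar_commute mult.commute)
    then have "E' *v (E *v v) = 0" by simp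
    then show False using E' \<open>v \<noteq> 0\<close> by (simp add: matrix_vector_mul_assoc)
  next
    case 2
    obtain u where u: "u \<notin> W" using W(3) by blast
    then have "vec.dim (insert u W) = 3" using 2 by (simp add: vec.dim_insert span)
    then have "vec.span (insert u W) = UNIV" by (rule full)
    then have decomp: "\<exists>k. v - k *s u \<in> W" for v
      using vec.span_breakdown_eq[of v u W] span by simp
    obtain x where x: "X *v u - x *s u \<in> W" using decomp by blast
    obtain y where y: "Y *v u - y *s u \<in> W" using decomp by blast
    \<comment> \<open>The multiples of \<open>u\<close> cancel, so only vectors of \<open>W\<close>
      remain: the commutator is zero modulo \<open>W\<close>.\<close>
    have "E *v u = X *v (Y *v u - y *s u) - Y *v (X *v u - x *s u)
        + y *s (X *v u - x *s u) - x *s (Y *v u - y *s u)"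
      by (simp add: E matrix_vector_mult_diff_distrib vector_scalar_commute
          vec.scale_right_diff_distrib mult.commute)
    also have "\<dots> \<in> W"
      by (rule vec.subspace_diff[OF W(1) vec.subspace_add[OF W(1) vec.subspace_diff[OF W(1)
          X[OF y] Y[OF x]] vec.subspace_scale[OF W(1) x]] vec.subspace_scale[OF W(1) y]])
    finally have Eu: "E *v u \<in> W" .
    have EW: "E *v w \<in> W" if "w \<in> W" for w
      unfolding E by (rule vec.subspace_diff[OF W(1) X[OF Y[OF that]] Y[OF X[OF that]]])
    \<comment> \<open>\<open>E\<close> maps the whole space into \<open>W\<close>, but being
      invertible it is also onto.\<close>
    have "v \<in> W" for v
    proof -
      obtain k where k: "E' *v v - k *s u \<in> W" using decomp by blast
      have "v = E *v (E' *v v - k *s u) + k *s (E *v u)"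
        by (simp add: matrix_vector_mult_diff_distrib vector_scalar_commute matrix_vector_mul_assoc E')
      also have "\<dots> \<in> W"
        by (rule vec.subspace_add[OF W(1) EW[OF k] vec.subspace_scale[OF W(1) Eu]])
      finally show ?thesis .
    qed
    then show False using W(3) by blast
  qed
qed

text \<open>The matrix \<open>C\<close> is a polynomial in \<open>A\<close> and \<open>B\<close>, so
  it preserves every subspace that they preserve.\<close>

lemma commutator_det_reducible:
  fixes A B :: "complex ^ 3 ^ 3"
  assumes "\<not> irreducible_pair A B"
  shows "commutator_det A B = 0"
proof -
  obtain W where W: "vec.subspace W" "W \<noteq> {0}" "W \<noteq> UNIV"
    and AB: "\<And>w. w \<in> W \<Longrightarrow> A *v w \<in> W" "\<And>w. w \<in> W \<Longrightarrow> B *v w \<in> W"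
    using assms unfolding irreducible_pair_def by blast
  have C: "(A ** B ** A - A ** B) *v w \<in> W" if "w \<in> W" for w
    using that AB W(1)
    by (simp add: matrix_vector_mult_diff_rdistrib matrix_vector_mul_assoc[symmetric] vec.subspace_diff)
  show ?thesis
    unfolding commutator_det_def Let_def
    by (rule det_commutator_invariant_subspace[OF W AB(2) C])
qed

section \<open>Representations of the trefoil group\<close>

lemma trefoil_in_carrier [simp]:
  "trefoil_x \<in> carrier trefoil_group" "trefoil_y \<in> carrier trefoil_group"
  by (simp_all add: trefoil_x_def trefoil_y_def trefoil_group_def presented_group_def)

lemma R_trefoil_hom: "\<rho> \<in> R_trefoil \<Longrightarrow> group_hom trefoil_group SL \<rho>"
  unfolding R_trefoil_def representations_def group_hom_def group_hom_axioms_def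
  by (simp add: group_SL trefoil_group_def group_presented_group)

lemma R_trefoil_det:
  assumes "\<rho> \<in> R_trefoil" "\<gamma> \<in> carrier trefoil_group" shows "det (\<rho> \<gamma>) = 1"
  using group_hom.hom_closed[OF R_trefoil_hom[OF assms(1)] assms(2)] by simp

lemma R_trefoil_relation:
  assumes "\<rho> \<in> R_trefoil"
  shows "\<rho> trefoil_x ** \<rho> trefoil_x = \<rho> trefoil_y ** \<rho> trefoil_y ** \<rho> trefoil_y"
proof -
  interpret group_hom trefoil_group SL \<rho> by (rule R_trefoil_hom[OF assms])
  have "trefoil_x \<otimes>\<^bsub>trefoil_group\<^esub> trefoil_x
      = trefoil_y \<otimes>\<^bsub>trefoil_group\<^esub> trefoil_y \<otimes>\<^bsub>trefoil_group\<^esub> trefoil_y"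
    unfolding trefoil_x_def trefoil_y_def trefoil_group_def word_class_mult word_class_eq_iff
    using word_equiv.relation[of _ _ trefoil_relations "[]" "[]"] by (simp add: trefoil_relations_def)
  from arg_cong[OF this, of \<rho>] show ?thesis by simp
qed

lemma R_trefoil_eqI:
  assumes "\<rho> \<in> R_trefoil" "\<rho>' \<in> R_trefoil"
    and "\<rho> trefoil_x = \<rho>' trefoil_x" "\<rho> trefoil_y = \<rho>' trefoil_y"
  shows "\<rho> = \<rho>'"
proof (rule presented_group_hom_eqI[of SL \<rho> trefoil_relations])
  fix g show "\<rho> (word_class trefoil_relations [(g, True)]) = \<rho>' (word_class trefoil_relations [(g, True)])"
    using assms(3,4) by (cases g) (simp_all add: trefoil_x_def trefoil_y_def)
qed (use assms group_SL in \<open>auto simp: R_trefoil_def representations_def trefoil_group_def\<close>)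

lemma R_trefoil_exists:
  assumes "det A = 1" "det B = 1" "A ** A = B ** B ** B"
  shows "\<exists>\<rho>\<in>R_trefoil. \<rho> trefoil_x = A \<and> \<rho> trefoil_y = B"
proof -
  define a where "a = (\<lambda>g. case g of Gen_x \<Rightarrow> A | Gen_y \<Rightarrow> B)"
  have "range a \<subseteq> carrier SL" using assms(1,2) by (auto simp: a_def split: trefoil_gen.split)
  moreover have "word_eval SL a l = word_eval SL a r" if "(l, r) \<in> trefoil_relations" for l r
    using that assms(3) by (auto simp: trefoil_relations_def a_def matrix_mul_assoc)
  ultimately obtain \<rho> where \<rho>: "\<rho> \<in> hom (presented_group trefoil_relations) SL"
    "\<rho> \<in> extensional (carrier (presented_group trefoil_relations))"
    "\<And>g. \<rho> (word_class trefoil_relations [(g, True)]) = a g"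
    using presented_group_universal[OF group_SL] by metis
  then have "\<rho> \<in> R_trefoil" by (simp add: R_trefoil_def representations_def trefoil_group_def)
  moreover have "\<rho> trefoil_x = A" "\<rho> trefoil_y = B"
    using \<rho>(3) by (simp_all add: trefoil_x_def trefoil_y_def a_def)
  ultimately show ?thesis by blast
qed

text \<open>A subspace invariant under the generators is invariant under their inverses by
  \<open>invariant_subspace_inverse\<close>, hence under the whole group.\<close>

lemma irreducible_rep_trefoil:
  assumes "\<rho> \<in> R_trefoil"
  shows "irreducible_rep trefoil_group \<rho> \<longleftrightarrow> irreducible_pair (\<rho> trefoil_x) (\<rho> trefoil_y)"
proof -
  interpret group_hom trefoil_group SL \<rho> by (rule R_trefoil_hom[OF assms])
  have "\<rho> \<gamma> *v w \<in> W"
    if W: "vec.subspace W" "\<forall>w\<in>W. \<rho> trefoil_x *v w \<in> W \<and> \<rho> trefoil_y *v w \<in> W"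
      and "\<gamma> \<in> carrier trefoil_group" "w \<in> W" for W \<gamma> w
  proof -
    have gen_cases: "word_class trefoil_relations [(g, True)] \<in> {trefoil_x, trefoil_y}" for g
      by (cases g) (simp_all add: trefoil_x_def trefoil_y_def)
    have 1: "\<rho> \<delta> *v w \<in> W" if "\<delta> \<in> {trefoil_x, trefoil_y}" "w \<in> W" for \<delta> w
      using that W(2) by blast
    have 2: "\<rho> (inv\<^bsub>trefoil_group\<^esub> \<delta>) *v w \<in> W" if "\<delta> \<in> {trefoil_x, trefoil_y}" "w \<in> W" for \<delta> w
    proof (rule invariant_subspace_inverse[OF _ W(1) 1])
      have \<delta>: "\<delta> \<in> carrier trefoil_group" using that(1) by auto
      then show "\<rho> (inv\<^bsub>trefoil_group\<^esub> \<delta>) ** \<rho> \<delta> = mat 1"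
        using inv_SL(2)[OF R_trefoil_det[OF assms]] by simp
    qed (use that in auto)
    have carr: "word_class trefoil_relations u \<in> carrier trefoil_group" for u
      by (simp add: trefoil_group_def presented_group_def)
    have "\<forall>w\<in>W. \<rho> \<gamma> *v w \<in> W"
      using \<open>\<gamma> \<in> carrier trefoil_group\<close>
    proof (induction rule: presented_group_induct[where Rel = trefoil_relations,
          folded trefoil_group_def, consumes 1, case_names one gen inv])
      case one
      then show ?case by simp
    next
      case (gen g U)
      then show ?case using 1[OF gen_cases[of g]]
        by (simp add: carr matrix_vector_mul_assoc[symmetric])
    next
      case (inv g U)
      then show ?case using 2[OF gen_cases[of g]]
        by (simp add: carr matrix_vector_mul_assoc[symmetric])
    qed
    then show ?thesis using \<open>w \<in> W\<close> by blast
  qed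
  then have "(\<forall>\<gamma>\<in>carrier trefoil_group. \<forall>w\<in>W. \<rho> \<gamma> *v w \<in> W) \<longleftrightarrow>
      (\<forall>w\<in>W. \<rho> trefoil_x *v w \<in> W \<and> \<rho> trefoil_y *v w \<in> W)" if "vec.subspace W" for W
    using that by (meson trefoil_in_carrier)
  then show ?thesis
    unfolding irreducible_rep_def irreducible_pair_def by (simp cong: conj_cong)
qed

lemma conjugate_trefoil [simp]:
  "conjugate trefoil_group g \<rho> trefoil_x = g ** \<rho> trefoil_x ** inv\<^bsub>SL\<^esub> g"
  "conjugate trefoil_group g \<rho> trefoil_y = g ** \<rho> trefoil_y ** inv\<^bsub>SL\<^esub> g"
  by (simp_all add: conjugate_def)

lemma conjugate_in_R_trefoil:
  assumes g: "det g = 1" and \<rho>: "\<rho> \<in> R_trefoil"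
  shows "conjugate trefoil_group g \<rho> \<in> R_trefoil"
proof -
  interpret group_hom trefoil_group SL \<rho> by (rule R_trefoil_hom[OF \<rho>])
  have "conjugate trefoil_group g \<rho> \<in> hom trefoil_group SL"
  proof (rule homI)
    fix x y assume xy: "x \<in> carrier trefoil_group" "y \<in> carrier trefoil_group"
    then show "conjugate trefoil_group g \<rho> x \<in> carrier SL"
      using g inv_SL[OF g] R_trefoil_det[OF \<rho>] by (simp add: conjugate_def det_mul)
    have "g ** (\<rho> x ** \<rho> y) ** inv\<^bsub>SL\<^esub> g = g ** \<rho> x ** (inv\<^bsub>SL\<^esub> g ** g) ** \<rho> y ** inv\<^bsub>SL\<^esub> g"
      using inv_SL[OF g] by (simp add: matrix_mul_assoc)
    also have "\<dots> = (g ** \<rho> x ** inv\<^bsub>SL\<^esub> g) ** (g ** \<rho> y ** inv\<^bsub>SL\<^esub> g)"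
      by (simp add: matrix_mul_assoc)
    finally show "conjugate trefoil_group g \<rho> (x \<otimes>\<^bsub>trefoil_group\<^esub> y) =
        conjugate trefoil_group g \<rho> x \<otimes>\<^bsub>SL\<^esub> conjugate trefoil_group g \<rho> y"
      using xy by (simp add: conjugate_def)
  qed
  then show ?thesis
    by (simp add: R_trefoil_def representations_def) (simp add: conjugate_def)
qed

lemma conjugate_eqI:
  assumes \<rho>: "\<rho> \<in> R_trefoil" "\<rho>' \<in> R_trefoil" and g: "det g = 1"
    and "\<rho> trefoil_x ** g = g ** \<rho>' trefoil_x" "\<rho> trefoil_y ** g = g ** \<rho>' trefoil_y"
  shows "\<rho> = conjugate trefoil_group g \<rho>'"
proof -
  have "M = g ** M' ** inv\<^bsub>SL\<^esub> g" if "M ** g = g ** M'" for M M'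
  proof -
    have "M = M ** (g ** inv\<^bsub>SL\<^esub> g)" using inv_SL[OF g] by simp
    also have "\<dots> = g ** M' ** inv\<^bsub>SL\<^esub> g" by (simp add: matrix_mul_assoc that)
    finally show ?thesis .
  qed
  then show ?thesis
    using assms by (intro R_trefoil_eqI conjugate_in_R_trefoil) simp_all
qed

lemma conjugate_intertwines:
  assumes "det g = 1"
  shows "conjugate trefoil_group g \<rho> trefoil_x ** g = g ** \<rho> trefoil_x"
    "conjugate trefoil_group g \<rho> trefoil_y ** g = g ** \<rho> trefoil_y"
  by (simp_all add: matrix_mul_assoc[symmetric] inv_SL[OF assms])

text \<open>This exhibits the irreducible locus as a principal open set. For irreducible pairs the
  determinant is evaluated on the normal form, where all weights are nonzero.\<close>

lemma R_irr_trefoil_iff: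
  "\<rho> \<in> R_irr_trefoil \<longleftrightarrow>
     \<rho> \<in> R_trefoil \<and> commutator_det (\<rho> trefoil_x) (\<rho> trefoil_y) \<noteq> 0"
proof (cases "\<rho> \<in> R_trefoil")
  case True
  have "commutator_det (\<rho> trefoil_x) (\<rho> trefoil_y) \<noteq> 0"
    if irr: "irreducible_pair (\<rho> trefoil_x) (\<rho> trefoil_y)"
  proof -
    obtain z K where K: "det K = 1" "\<rho> trefoil_x ** K = K ** reflection3 z"
      "\<rho> trefoil_y ** K = K ** diag3" "\<And>i. weights z $ i \<noteq> 0"
      using irreducible_pair_normal_form[OF irr R_trefoil_relation[OF True]]
        R_trefoil_det[OF True] by (metis trefoil_in_carrier)
    then show ?thesis
      using commutator_det_similar[of K] by (simp add: commutator_det_reflection3)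
  qed
  with True show ?thesis
    unfolding R_irr_trefoil_def using irreducible_rep_trefoil commutator_det_reducible by blast
qed (simp add: R_irr_trefoil_def)

lemma conjugate_in_R_irr_trefoil:
  assumes g: "det g = 1" and \<rho>: "\<rho> \<in> R_irr_trefoil"
  shows "conjugate trefoil_group g \<rho> \<in> R_irr_trefoil"
  using \<rho> g conjugate_in_R_trefoil[OF g]
    commutator_det_similar[OF _ conjugate_intertwines[OF g], of \<rho> \<rho>]
  by (simp add: R_irr_trefoil_iff del: conjugate_trefoil)

lemma conjugate_R_irr_trefoil:
  assumes g: "det g = 1"
  shows "conjugate trefoil_group g ` R_irr_trefoil = R_irr_trefoil"
proof
  show "R_irr_trefoil \<subseteq> conjugate trefoil_group g ` R_irr_trefoil"
  proof
    fix \<rho> assume \<rho>: "\<rho> \<in> R_irr_trefoil"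
    let ?\<rho>' = "conjugate trefoil_group (inv\<^bsub>SL\<^esub> g) \<rho>"
    have \<rho>': "?\<rho>' \<in> R_irr_trefoil" by (rule conjugate_in_R_irr_trefoil[OF inv_SL(1)[OF g] \<rho>])
    interpret group "SL :: (complex ^ 3 ^ 3) monoid" by (rule group_SL)
    have "inv\<^bsub>SL\<^esub> (inv\<^bsub>SL\<^esub> g) = g" using g by (intro inv_inv) simp
    then have "\<rho> = conjugate trefoil_group g ?\<rho>'"
      using \<rho> \<rho>' g inv_SL[OF g]
      by (intro conjugate_eqI) (auto simp: R_irr_trefoil_iff matrix_mul_assoc)
    then show "\<rho> \<in> conjugate trefoil_group g ` R_irr_trefoil" using \<rho>' by blast
  qed
qed (use conjugate_in_R_irr_trefoil[OF g] in blast)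

section \<open>The invariants and the section\<close>

lemma trace_similar:
  fixes K X X' :: "complex ^ 'n ^ 'n"
  assumes "det K \<noteq> 0" "X ** K = K ** X'"
  shows "trace X = trace X'"
proof -
  obtain K' where K': "K' ** K = mat 1" "K ** K' = mat 1"
    using assms(1) by (metis invertible_det_nz invertible_def)
  have "trace X = trace ((X ** K) ** K')" by (simp add: matrix_mul_assoc[symmetric] K')
  also have "\<dots> = trace (K' ** (K ** X'))" unfolding assms(2) by (rule trace_mul_sym)
  finally show ?thesis by (simp add: matrix_mul_assoc K')
qed

text \<open>This is the trace of the product of \<open>(A + 1) / 2\<close> with \<open>(1 + c B + c\<^sup>2 B\<^sup>2) / 3\<close>, which is the
  projection of \<open>B\<close> to the eigenvalue \<open>1 / c\<close> if \<open>B ^ 3 = 1\<close> and \<open>c ^ 3 = 1\<close>.\<close>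

definition trace_weight :: "complex \<Rightarrow> complex ^ 3 ^ 3 \<Rightarrow> complex ^ 3 ^ 3 \<Rightarrow> complex" where
  "trace_weight c A B = (1 / 6) * (3 + trace A + c * (trace B + trace (A ** B))
     + c\<^sup>2 * (trace (B ** B) + trace (A ** B ** B)))"

lemma trace_weight_similar:
  assumes K: "det K \<noteq> 0" and A: "A ** K = K ** A'" and B: "B ** K = K ** B'"
  shows "trace_weight c A B = trace_weight c A' B'"
proof -
  have mult: "X ** Y ** K = K ** (X' ** Y')" if "X ** K = K ** X'" "Y ** K = K ** Y'" for X X' Y Y'
    using that by (metis matrix_mul_assoc)
  show ?thesis
    unfolding trace_weight_def
    by (simp only: trace_similar[OF K A] trace_similar[OF K B] trace_similar[OF K mult[OF A B]]
        trace_similar[OF K mult[OF B B]] trace_similar[OF K mult[OF mult[OF A B] B]])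
qed

text \<open>The trace of the rank-one projection times the projection to a coordinate axis is a
  diagonal entry, that is, a weight. The value \<open>c = cbrt1\<^sup>2\<close> selects the
  eigenvalue \<open>1 / c = cbrt1\<close>, which belongs to the second axis.\<close>

lemma trace_weight_reflection3:
  "trace_weight 1 (reflection3 z) diag3 = z $ 1"
  "trace_weight (cbrt1\<^sup>2) (reflection3 z) diag3 = z $ 2"
proof -
  define w where "w = cbrt1"
  have w: "w * w = - 1 - w" unfolding w_def using cbrt1_power2 by (simp add: power2_eq_square)
  have c2: "cbrt1\<^sup>2 = w * w" by (simp add: w_def power2_eq_square)
  have "trace (reflection3 z) = - 1"
    by (simp add: trace_def sum_3 reflection3_def weights_def)
  moreover have "trace diag3 = 1 + w + w * w"
    by (simp add: trace_def sum_3 diag3_def c2 w_def)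
  moreover have "trace (diag3 ** diag3) = 1 + w * w + w * w * (w * w)"
    by (simp add: trace_def sum_3 diag3_def matrix_matrix_mult_def c2 w_def)
  moreover have "trace (reflection3 z ** diag3) =
      (2 * z $ 1 - 1) + w * (2 * z $ 2 - 1) + w * w * (1 - 2 * z $ 1 - 2 * z $ 2)"
    by (simp add: trace_def sum_3 diag3_def reflection3_def weights_def matrix_matrix_mult_def c2
        w_def algebra_simps)
  moreover have "trace (reflection3 z ** diag3 ** diag3) =
      (2 * z $ 1 - 1) + w * w * (2 * z $ 2 - 1) + w * w * (w * w) * (1 - 2 * z $ 1 - 2 * z $ 2)"
    by (simp add: trace_def sum_3 diag3_def reflection3_def weights_def matrix_matrix_mult_def c2
        w_def algebra_simps)
  ultimately show "trace_weight 1 (reflection3 z) diag3 = z $ 1"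
    "trace_weight (cbrt1\<^sup>2) (reflection3 z) diag3 = z $ 2"
    unfolding trace_weight_def c2 unfolding power2_eq_square using w by (simp_all only:) algebra+
qed

definition trefoil_invariants :: "(trefoil_gen word set \<Rightarrow> complex ^ 3 ^ 3) \<Rightarrow> complex ^ 2" where
  "trefoil_invariants \<rho> = vector [trace_weight 1 (\<rho> trefoil_x) (\<rho> trefoil_y),
     trace_weight (cbrt1\<^sup>2) (\<rho> trefoil_x) (\<rho> trefoil_y)]"

text \<open>The choice is harmless: the values at the two generators determine a representation by
  \<open>R_trefoil_eqI\<close>.\<close>

definition trefoil_section :: "complex ^ 2 \<Rightarrow> trefoil_gen word set \<Rightarrow> complex ^ 3 ^ 3" where
  "trefoil_section z = (SOME \<rho>. \<rho> \<in> R_trefoil \<and> \<rho> trefoil_x = reflection3 z \<and> \<rho> trefoil_y = diag3)"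

lemma trefoil_section:
  "trefoil_section z \<in> R_trefoil" "trefoil_section z trefoil_x = reflection3 z"
  "trefoil_section z trefoil_y = diag3"
proof -
  have "\<exists>\<rho>. \<rho> \<in> R_trefoil \<and> \<rho> trefoil_x = reflection3 z \<and> \<rho> trefoil_y = diag3"
    using R_trefoil_exists[of "reflection3 z" diag3] det_reflection3 det_diag3 reflection3_square
      diag3_cube by metis
  from someI_ex[OF this] show "trefoil_section z \<in> R_trefoil"
    "trefoil_section z trefoil_x = reflection3 z" "trefoil_section z trefoil_y = diag3"
    unfolding trefoil_section_def by blast+
qed

lemma trefoil_invariants_section: "trefoil_invariants (trefoil_section z) = z"
  by (simp add: trefoil_invariants_def trefoil_section trace_weight_reflection3 vec_eq_iff forall_2)

lemma trefoil_invariants_similar: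
  assumes "det K \<noteq> 0" "\<rho> trefoil_x ** K = K ** \<rho>' trefoil_x" "\<rho> trefoil_y ** K = K ** \<rho>' trefoil_y"
  shows "trefoil_invariants \<rho> = trefoil_invariants \<rho>'"
  unfolding trefoil_invariants_def by (simp add: trace_weight_similar[OF assms])

lemma trefoil_invariants_conjugate:
  "det g = 1 \<Longrightarrow> trefoil_invariants (conjugate trefoil_group g \<rho>) = trefoil_invariants \<rho>"
  by (rule trefoil_invariants_similar[of g]) (simp_all only: conjugate_intertwines, simp)

lemma trefoil_section_irreducible:
  "trefoil_section z \<in> R_irr_trefoil \<longleftrightarrow> z $ 1 * z $ 2 * (1 - z $ 1 - z $ 2) \<noteq> 0"
  by (simp add: R_irr_trefoil_iff trefoil_section commutator_det_reflection3 weights_def)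

text \<open>The parameter of the normal form can only be \<open>trefoil_invariants \<rho>\<close>,
  since the invariants do not change under conjugation and recover the parameter on the
  section.\<close>

lemma R_irr_trefoil_conjugate_section:
  assumes "\<rho> \<in> R_irr_trefoil"
  obtains K where "det K = 1" "\<rho> = conjugate trefoil_group K (trefoil_section (trefoil_invariants \<rho>))"
    "trefoil_section (trefoil_invariants \<rho>) \<in> R_irr_trefoil"
proof -
  have \<rho>: "\<rho> \<in> R_trefoil" and irr: "irreducible_pair (\<rho> trefoil_x) (\<rho> trefoil_y)"
    using assms irreducible_rep_trefoil by (auto simp: R_irr_trefoil_def)
  obtain z K where K: "det K = 1" "\<rho> trefoil_x ** K = K ** reflection3 z"
      "\<rho> trefoil_y ** K = K ** diag3" "\<And>i. weights z $ i \<noteq> 0"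
    using irreducible_pair_normal_form[OF irr R_trefoil_relation[OF \<rho>]] R_trefoil_det[OF \<rho>]
    by (metis trefoil_in_carrier)
  have "trefoil_invariants \<rho> = trefoil_invariants (trefoil_section z)"
    using K by (intro trefoil_invariants_similar[of K]) (simp_all add: trefoil_section)
  then have z: "trefoil_invariants \<rho> = z" by (simp add: trefoil_invariants_section)
  show thesis
  proof (rule that[OF K(1)])
    show "\<rho> = conjugate trefoil_group K (trefoil_section (trefoil_invariants \<rho>))"
      unfolding z using K by (intro conjugate_eqI \<rho> trefoil_section) (simp_all add: trefoil_section)
    show "trefoil_section (trefoil_invariants \<rho>) \<in> R_irr_trefoil"
      unfolding z trefoil_section_irreducible
      using K(4)[of 1] K(4)[of 2] K(4)[of 3] by (simp add: weights_def)
  qed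
qed

section \<open>Polynomiality\<close>

definition poly_matrix :: "('p \<Rightarrow> complex) set \<Rightarrow> ('p \<Rightarrow> complex ^ 'n ^ 'm) \<Rightarrow> bool" where
  "poly_matrix C F \<longleftrightarrow> (\<forall>i j. (\<lambda>p. F p $ i $ j) \<in> poly_functions C)"

lemma poly_matrix_const: "poly_matrix C (\<lambda>_. M)"
  by (simp add: poly_matrix_def poly_functions.const)

lemma poly_matrix_diff: "poly_matrix C F \<Longrightarrow> poly_matrix C G \<Longrightarrow> poly_matrix C (\<lambda>p. F p - G p)"
  by (simp add: poly_matrix_def poly_functions_diff)

lemma poly_matrix_mult: "poly_matrix C F \<Longrightarrow> poly_matrix C G \<Longrightarrow> poly_matrix C (\<lambda>p. F p ** G p)"
  by (auto simp: poly_matrix_def matrix_matrix_mult_def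
      intro!: poly_functions_sum poly_functions.mult)

lemma poly_functions_trace: "poly_matrix C F \<Longrightarrow> (\<lambda>p. trace (F p)) \<in> poly_functions C"
  by (auto simp: poly_matrix_def trace_def intro!: poly_functions_sum)

lemma poly_functions_det: "poly_matrix C F \<Longrightarrow> (\<lambda>p. det (F p)) \<in> poly_functions C"
  by (auto simp: poly_matrix_def det_def
      intro!: poly_functions_sum poly_functions.mult poly_functions_prod poly_functions.const)

lemma poly_matrix_rep_coords: "\<gamma> \<in> S \<Longrightarrow> poly_matrix (rep_coords S) (\<lambda>\<rho>. \<rho> \<gamma>)"
  by (auto simp: poly_matrix_def rep_coords_def intro!: poly_functions.coord)

lemma poly_map_rep_coords:
  "(\<And>\<gamma>. \<gamma> \<in> S \<Longrightarrow> poly_matrix C (\<lambda>p. \<phi> p \<gamma>)) \<Longrightarrow> poly_map C (rep_coords S) \<phi>"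
  by (auto simp: poly_map_def rep_coords_def poly_matrix_def)

lemma poly_map_affine_coords:
  "(\<And>i. (\<lambda>p. \<phi> p $ i) \<in> poly_functions C) \<Longrightarrow> poly_map C affine_coords \<phi>"
  by (auto simp: poly_map_def affine_coords_def)

lemma poly_map_compose:
  "poly_map C D \<phi> \<Longrightarrow> poly_map D E \<psi> \<Longrightarrow> poly_map C E (\<lambda>p. \<psi> (\<phi> p))"
  using poly_map_pullback[of C D \<phi>] by (auto simp: poly_map_def)

lemma poly_matrix_trefoil:
  "poly_matrix trefoil_coords (\<lambda>\<rho>. \<rho> trefoil_x)" "poly_matrix trefoil_coords (\<lambda>\<rho>. \<rho> trefoil_y)"
  by (simp_all add: poly_matrix_rep_coords)

lemma poly_functions_commutator_det:
  "(\<lambda>\<rho>. commutator_det (\<rho> trefoil_x) (\<rho> trefoil_y)) \<in> poly_functions trefoil_coords"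
  unfolding commutator_det_def Let_def
  by (intro poly_functions_det poly_matrix_diff poly_matrix_mult poly_matrix_trefoil)

lemma poly_map_trefoil_invariants: "poly_map trefoil_coords affine_coords trefoil_invariants"
proof (rule poly_map_affine_coords)
  have "(\<lambda>\<rho>. trace_weight c (\<rho> trefoil_x) (\<rho> trefoil_y)) \<in> poly_functions trefoil_coords" for c
    unfolding trace_weight_def
    by (intro poly_functions.add poly_functions.mult poly_functions.const poly_functions_trace
        poly_matrix_mult poly_matrix_trefoil)
  then show "(\<lambda>\<rho>. trefoil_invariants \<rho> $ i) \<in> poly_functions trefoil_coords" for i
    using exhaust_2[of i] by (auto simp: trefoil_invariants_def)
qed

lemma poly_functions_affine_coord: "(\<lambda>z. z $ i) \<in> poly_functions affine_coords"
  by (rule poly_functions.coord) (auto simp: affine_coords_def)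

lemma poly_functions_weights: "(\<lambda>z. weights z $ i) \<in> poly_functions affine_coords"
proof -
  have "(\<lambda>z :: complex ^ 2. 1 - z $ 1 - z $ 2) \<in> poly_functions affine_coords"
    by (intro poly_functions_diff poly_functions.const poly_functions_affine_coord)
  then show ?thesis
    using exhaust_3[of i] by (auto simp: weights_def poly_functions_affine_coord)
qed

lemma poly_map_trefoil_section: "poly_map affine_coords trefoil_coords trefoil_section"
proof (rule poly_map_rep_coords)
  have "poly_matrix affine_coords reflection3"
    unfolding poly_matrix_def
  proof (intro allI)
    fix i j
    have "(\<lambda>z. 2 * weights z $ i - (if i = j then 1 else 0)) \<in> poly_functions affine_coords"
      by (intro poly_functions_diff poly_functions.mult poly_functions.const poly_functions_weights)
    then show "(\<lambda>z. reflection3 z $ i $ j) \<in> poly_functions affine_coords"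
      by (simp add: reflection3_def)
  qed
  then show "poly_matrix affine_coords (\<lambda>z. trefoil_section z \<gamma>)" if "\<gamma> \<in> {trefoil_x, trefoil_y}" for \<gamma>
    using that by (auto simp: trefoil_section poly_matrix_const)
qed

lemma poly_map_conjugate: "poly_map trefoil_coords trefoil_coords (conjugate trefoil_group g)"
  by (rule poly_map_rep_coords)
    (auto intro!: poly_matrix_mult poly_matrix_const poly_matrix_trefoil)

lemma poly_functions_affine_line:
  fixes z d :: "complex ^ 'n"
  assumes "f \<in> poly_functions affine_coords"
  shows "\<exists>p. \<forall>t. f (z + t *s d) = poly p t"
  using assms
proof induction
  case (const c)
  show ?case by (rule exI[of _ "[:c:]"]) simp
next
  case (coord f)
  then obtain i where "f = (\<lambda>v. v $ i)" by (auto simp: affine_coords_def)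
  then show ?case by (intro exI[of _ "[:z $ i, d $ i:]"]) simp
next
  case (add f g)
  then show ?case by (metis poly_add)
next
  case (mult f g)
  then show ?case by (metis poly_mult)
qed

text \<open>Irreducibility of affine space, seen on the line joining \<open>z\<close> and
  \<open>z'\<close>: the restrictions are nonzero polynomials in one variable, so their product is
  nonzero and takes a nonzero value.\<close>

lemma poly_functions_affine_common_nonzero:
  fixes z z' :: "complex ^ 'n"
  assumes f: "f \<in> poly_functions affine_coords" "f z \<noteq> 0"
    and g: "g \<in> poly_functions affine_coords" "g z' \<noteq> 0"
  shows "\<exists>y. f y \<noteq> 0 \<and> g y \<noteq> 0"
proof -
  obtain p where p: "\<And>t. f (z + t *s (z' - z)) = poly p t"
    using poly_functions_affine_line[OF f(1)] by metis
  obtain q where q: "\<And>t. g (z + t *s (z' - z)) = poly q t"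
    using poly_functions_affine_line[OF g(1)] by metis
  have "poly p 0 \<noteq> 0" "poly q 1 \<noteq> 0" using p[of 0] q[of 1] f g by auto
  then have "p * q \<noteq> 0" by auto
  then obtain t where "poly (p * q) t \<noteq> 0" using poly_all_0_iff_0 by blast
  then show ?thesis using p[of t] q[of t] by (intro exI[of _ "z + t *s (z' - z)"]) simp
qed

section \<open>The closure of the irreducible representations\<close>

lemma R_irr_subset: "R_irr_trefoil \<subseteq> R_trefoil"
  by (auto simp: R_irr_trefoil_def)

lemma R_irr_closure_iff:
  "\<rho> \<in> R_irr_closure_trefoil \<longleftrightarrow> \<rho> \<in> R_trefoil \<and>
     (\<forall>f\<in>poly_functions trefoil_coords. f \<rho> \<noteq> 0 \<longrightarrow> (\<exists>\<rho>'\<in>R_irr_trefoil. f \<rho>' \<noteq> 0))"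
  unfolding R_irr_closure_trefoil_def in_closure_of_zariski using R_irr_subset
  by (simp add: Int_absorb2)

lemma R_irr_subset_closure: "R_irr_trefoil \<subseteq> R_irr_closure_trefoil"
  using R_irr_subset by (auto simp: R_irr_closure_iff)

lemma openin_R_irr_trefoil: "openin (zariski trefoil_coords R_trefoil) R_irr_trefoil"
proof -
  have eq: "R_irr_trefoil = {\<rho> \<in> R_trefoil. commutator_det (\<rho> trefoil_x) (\<rho> trefoil_y) \<noteq> 0}"
    by (auto simp: R_irr_trefoil_iff)
  show ?thesis unfolding eq by (rule openin_zariski_principal[OF poly_functions_commutator_det])
qed

text \<open>Conjugation is a polynomial map that preserves the irreducible locus, so a test
  polynomial for the closure can be pulled back along it.\<close>

lemma conjugate_in_closure:
  assumes g: "det g = 1" and \<rho>: "\<rho> \<in> R_irr_closure_trefoil"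
  shows "conjugate trefoil_group g \<rho> \<in> R_irr_closure_trefoil"
  unfolding R_irr_closure_iff
proof (intro conjI ballI impI)
  show "conjugate trefoil_group g \<rho> \<in> R_trefoil"
    using conjugate_in_R_trefoil[OF g] \<rho> by (simp add: R_irr_closure_iff)
  fix f :: "(trefoil_gen word set \<Rightarrow> complex ^ 3 ^ 3) \<Rightarrow> complex"
  assume "f \<in> poly_functions trefoil_coords" and nz: "f (conjugate trefoil_group g \<rho>) \<noteq> 0"
  then have f: "(\<lambda>\<rho>. f (conjugate trefoil_group g \<rho>)) \<in> poly_functions trefoil_coords"
    using poly_map_pullback[OF poly_map_conjugate] by blast
  have "\<forall>f\<in>poly_functions trefoil_coords. f \<rho> \<noteq> 0 \<longrightarrow> (\<exists>\<rho>'\<in>R_irr_trefoil. f \<rho>' \<noteq> 0)"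
    using \<rho>[unfolded R_irr_closure_iff] by (rule conjunct2)
  from bspec[OF this f] nz obtain \<rho>' where
    "\<rho>' \<in> R_irr_trefoil" "f (conjugate trefoil_group g \<rho>') \<noteq> 0"
    by (elim impE bexE)
  then show "\<exists>\<rho>'\<in>R_irr_trefoil. f \<rho>' \<noteq> 0" using conjugate_in_R_irr_trefoil[OF g] by blast
qed

lemma poly_functions_triangle:
  "(\<lambda>z :: complex ^ 2. z $ 1 * z $ 2 * (1 - z $ 1 - z $ 2)) \<in> poly_functions affine_coords"
  by (intro poly_functions.mult poly_functions_diff poly_functions.const poly_functions_affine_coord)

text \<open>Along the section a test polynomial becomes a polynomial on the plane. If nonzero
  somewhere, it is nonzero at a point off the three lines, where the section is irreducible.\<close>

lemma trefoil_section_in_closure: "trefoil_section z \<in> R_irr_closure_trefoil"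
  unfolding R_irr_closure_iff
proof (intro conjI ballI impI)
  fix f :: "(trefoil_gen word set \<Rightarrow> complex ^ 3 ^ 3) \<Rightarrow> complex"
  assume "f \<in> poly_functions trefoil_coords" and nz: "f (trefoil_section z) \<noteq> 0"
  then have f: "(\<lambda>z. f (trefoil_section z)) \<in> poly_functions affine_coords"
    using poly_map_pullback[OF poly_map_trefoil_section] by blast
  \<comment> \<open>Any point off the three lines would serve; here the product is 3.\<close>
  let ?v = "vector [-1, -1] :: complex ^ 2"
  have "?v $ 1 * ?v $ 2 * (1 - ?v $ 1 - ?v $ 2) \<noteq> 0" by simp
  then have "\<exists>y. f (trefoil_section y) \<noteq> 0 \<and> y $ 1 * y $ 2 * (1 - y $ 1 - y $ 2) \<noteq> 0"
    by (rule poly_functions_affine_common_nonzero[OF f nz poly_functions_triangle])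
  then show "\<exists>\<rho>'\<in>R_irr_trefoil. f \<rho>' \<noteq> 0" using trefoil_section_irreducible by blast
qed (rule trefoil_section)

text \<open>An irreducible representation lies in the orbit of its section point, and invariant
  functions are constant on orbits.\<close>

lemma invariant_eq_section:
  assumes f: "f \<in> invariant_functions SL (conjugate trefoil_group) (subvariety trefoil_coords X)"
    and "R_irr_trefoil \<subseteq> X" "\<rho> \<in> R_irr_trefoil"
  shows "f (trefoil_section (trefoil_invariants \<rho>)) = f \<rho>"
proof -
  obtain K where K: "det K = 1"
      "\<rho> = conjugate trefoil_group K (trefoil_section (trefoil_invariants \<rho>))"
      "trefoil_section (trefoil_invariants \<rho>) \<in> R_irr_trefoil"
    using R_irr_trefoil_conjugate_section[OF assms(3)] .
  have "f (conjugate trefoil_group K \<rho>') = f \<rho>'" if "\<rho>' \<in> R_irr_trefoil" for \<rho>'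
    using f that K(1) assms(2) by (auto simp: invariant_functions_def subvariety_def)
  from this[OF K(3)] show ?thesis using K(2) by simp
qed

lemma affine_coords_separate: "(\<And>f. f \<in> affine_coords \<Longrightarrow> f y = f y') \<Longrightarrow> y = y'"
  by (auto simp: affine_coords_def vec_eq_iff)

section \<open>The two quotients and the three lines\<close>

lemma GIT_R_irr_closure:
  "variety_isomorphic
     (GIT_quotient (SL :: (complex ^ 3 ^ 3) monoid) (conjugate trefoil_group)
        (subvariety trefoil_coords R_irr_closure_trefoil))
     (subvariety affine_coords (UNIV :: (complex ^ 2) set))"
proof (rule GIT_quotient_isomorphic_section[OF poly_map_trefoil_invariants _
      poly_map_trefoil_section])
  show "trefoil_section ` UNIV \<subseteq> R_irr_closure_trefoil" using trefoil_section_in_closure by blast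
  show "trefoil_invariants (trefoil_section z) = z" for z by (rule trefoil_invariants_section)
  fix g :: "complex ^ 3 ^ 3" and \<rho> assume "g \<in> carrier SL" "\<rho> \<in> R_irr_closure_trefoil"
  then show "conjugate trefoil_group g \<rho> \<in> R_irr_closure_trefoil \<and>
      trefoil_invariants (conjugate trefoil_group g \<rho>) = trefoil_invariants \<rho>"
    using conjugate_in_closure trefoil_invariants_conjugate by simp
next
  fix f \<rho>
  assume f: "f \<in> invariant_functions SL (conjugate trefoil_group)
      (subvariety trefoil_coords R_irr_closure_trefoil)" and \<rho>: "\<rho> \<in> R_irr_closure_trefoil"
  let ?g = "\<lambda>\<rho>\<in>R_irr_closure_trefoil. f (trefoil_section (trefoil_invariants \<rho>))"
  have reg: "f \<in> regular_functions trefoil_coords R_irr_closure_trefoil"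
    using f by (simp add: invariant_functions_def subvariety_def)
  \<comment> \<open>For reducible points of the closure no conjugacy with the section is available;
    the identity is proved on the irreducible locus and extended by density.\<close>
  have "?g = f"
  proof (rule regular_functions_eq_on_closure[where R = R_trefoil, OF _ reg _ R_irr_subset_closure])
    show "?g \<in> regular_functions trefoil_coords R_irr_closure_trefoil"
      by (rule regular_functions_pullback[OF poly_map_compose[OF poly_map_trefoil_invariants
          poly_map_trefoil_section] _ reg]) (use trefoil_section_in_closure in blast)
    show "?g \<rho> = f \<rho>" if "\<rho> \<in> R_irr_trefoil" for \<rho>
      using that invariant_eq_section[OF f R_irr_subset_closure that] R_irr_subset_closure by auto
  qed (simp add: R_irr_closure_trefoil_def)
  from fun_cong[OF this, of \<rho>] show "f (trefoil_section (trefoil_invariants \<rho>)) = f \<rho>"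
    using \<rho> by simp
next
  fix \<xi> assume "\<xi> \<in> algebra_characters (UNIV :: (complex ^ 2) set) (regular_functions affine_coords UNIV)"
  then show "\<exists>y\<in>UNIV. \<forall>g\<in>regular_functions affine_coords UNIV. \<xi> g = g y"
    \<comment> \<open>The whole plane is the nonvanishing locus of the constant
      \<open>h = 1\<close>.\<close>
    using algebra_characters_affine[OF poly_functions.const[of 1], of \<xi>] by simp
qed (auto intro: affine_coords_separate)

lemma GIT_R_irr:
  "variety_isomorphic
     (GIT_quotient (SL :: (complex ^ 3 ^ 3) monoid) (conjugate trefoil_group)
        (subvariety trefoil_coords R_irr_trefoil))
     (subvariety affine_coords {z :: complex ^ 2. z $ 1 * z $ 2 * (1 - z $ 1 - z $ 2) \<noteq> 0})"
    (is "variety_isomorphic _ (subvariety _ ?U)")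
proof (rule GIT_quotient_isomorphic_section[OF poly_map_trefoil_invariants _
      poly_map_trefoil_section])
  show "trefoil_section ` ?U \<subseteq> R_irr_trefoil" using trefoil_section_irreducible by blast
  show "trefoil_invariants ` R_irr_trefoil \<subseteq> ?U"
  proof
    fix z assume "z \<in> trefoil_invariants ` R_irr_trefoil"
    then obtain \<rho> where \<rho>: "\<rho> \<in> R_irr_trefoil" "z = trefoil_invariants \<rho>" by blast
    have "trefoil_section z \<in> R_irr_trefoil"
      using R_irr_trefoil_conjugate_section[OF \<rho>(1)] \<rho>(2) by blast
    then show "z \<in> ?U" using trefoil_section_irreducible by blast
  qed
  show "trefoil_invariants (trefoil_section z) = z" for z by (rule trefoil_invariants_section)
  fix g :: "complex ^ 3 ^ 3" and \<rho> assume "g \<in> carrier SL" "\<rho> \<in> R_irr_trefoil"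
  then show "conjugate trefoil_group g \<rho> \<in> R_irr_trefoil \<and>
      trefoil_invariants (conjugate trefoil_group g \<rho>) = trefoil_invariants \<rho>"
    using conjugate_in_R_irr_trefoil trefoil_invariants_conjugate by simp
next
  fix f \<rho>
  assume "f \<in> invariant_functions SL (conjugate trefoil_group)
      (subvariety trefoil_coords R_irr_trefoil)" "\<rho> \<in> R_irr_trefoil"
  then show "f (trefoil_section (trefoil_invariants \<rho>)) = f \<rho>"
    by (rule invariant_eq_section[OF _ subset_refl])
next
  fix \<xi> assume "\<xi> \<in> algebra_characters ?U (regular_functions affine_coords ?U)"
  from algebra_characters_affine[OF poly_functions_triangle this]
  show "\<exists>y\<in>?U. \<forall>g\<in>regular_functions affine_coords ?U. \<xi> g = g y" by blast
qed (auto intro: affine_coords_separate)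

lemma triangle_lines:
  fixes L1 L2 L3 :: "(complex ^ 2) set"
  defines "L1 \<equiv> {z. z $ 1 = 0}" and "L2 \<equiv> {z. z $ 2 = 0}" and "L3 \<equiv> {z. z $ 1 + z $ 2 = 1}"
  shows "complex_affine_line L1" "complex_affine_line L2" "complex_affine_line L3"
    "lines_general_position L1 L2 L3"
    "UNIV - (L1 \<union> L2 \<union> L3) = {z. z $ 1 * z $ 2 * (1 - z $ 1 - z $ 2) \<noteq> 0}"
proof -
  have line: "complex_affine_line L"
    if "d \<noteq> 0" "\<And>z. z \<in> L \<longleftrightarrow> (\<exists>c. z = p + c *s d)" for L and p d :: "complex ^ 2"
    unfolding complex_affine_line_def using that by (intro exI[of _ p] exI[of _ d]) blast
  show "complex_affine_line L1"
    by (rule line[of "vector [0, 1]" _ 0])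
      (auto simp: L1_def vec_eq_iff forall_2)
  show "complex_affine_line L2"
    by (rule line[of "vector [1, 0]" _ 0])
      (auto simp: L2_def vec_eq_iff forall_2)
  show "complex_affine_line L3"
    by (rule line[of "vector [1, -1]" _ "vector [0, 1]"])
      (auto simp: L3_def vec_eq_iff forall_2 algebra_simps)
  have "L1 \<inter> L2 = {0}" by (auto simp: L1_def L2_def vec_eq_iff forall_2)
  moreover have "L1 \<inter> L3 = {vector [0, 1]}"
    by (auto simp: L1_def L3_def vec_eq_iff forall_2)
  moreover have "L2 \<inter> L3 = {vector [1, 0]}"
    by (auto simp: L2_def L3_def vec_eq_iff forall_2)
  moreover have "L1 \<inter> L2 \<inter> L3 = {}" by (auto simp: L1_def L2_def L3_def)
  ultimately show "lines_general_position L1 L2 L3" unfolding lines_general_position_def by blast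
  have "1 - z $ 1 - z $ 2 = 0 \<longleftrightarrow> z $ 1 + z $ 2 = 1" for z :: "complex ^ 2"
    by (auto simp: algebra_simps)
  then show "UNIV - (L1 \<union> L2 \<union> L3) = {z. z $ 1 * z $ 2 * (1 - z $ 1 - z $ 2) \<noteq> 0}"
    by (auto simp: L1_def L2_def L3_def)
qed

theorem theorem9p10:
  shows "variety_isomorphic
           (GIT_quotient (SL :: (complex ^ 3 ^ 3) monoid) (conjugate trefoil_group)
              (subvariety trefoil_coords R_irr_closure_trefoil))
           (subvariety affine_coords (UNIV :: (complex ^ 2) set))
       \<and> openin (zariski trefoil_coords R_trefoil) R_irr_trefoil
       \<and> (\<forall>g \<in> carrier SL. conjugate trefoil_group g ` R_irr_trefoil = R_irr_trefoil)
       \<and> (\<exists>L1 L2 L3. complex_affine_line L1 \<and> complex_affine_line L2 \<and> complex_affine_line L3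
            \<and> lines_general_position L1 L2 L3
            \<and> variety_isomorphic
                (GIT_quotient (SL :: (complex ^ 3 ^ 3) monoid) (conjugate trefoil_group)
                   (subvariety trefoil_coords R_irr_trefoil))
                (subvariety affine_coords (UNIV - (L1 \<union> L2 \<union> L3))))"
proof (intro conjI ballI)
  show "\<exists>L1 L2 L3. complex_affine_line L1 \<and> complex_affine_line L2 \<and> complex_affine_line L3
            \<and> lines_general_position L1 L2 L3
            \<and> variety_isomorphic
                (GIT_quotient (SL :: (complex ^ 3 ^ 3) monoid) (conjugate trefoil_group)
                   (subvariety trefoil_coords R_irr_trefoil))
                (subvariety affine_coords (UNIV - (L1 \<union> L2 \<union> L3)))"
    \<comment> \<open>The zero loci of the three \<open>weights\<close>.\<close>
    by (intro exI[of _ "{z. z $ 1 = 0}"] exI[of _ "{z. z $ 2 = 0}"] exI[of _ "{z. z $ 1 + z $ 2 = 1}"]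
        conjI triangle_lines(1-4)) (simp only: triangle_lines(5) GIT_R_irr)
qed (simp_all add: GIT_R_irr_closure openin_R_irr_trefoil conjugate_R_irr_trefoil)

end
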